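(* Assume that $\alpha\in(0,2)$. For any $x_0\in\mathbb{R}$ and for any sequence $(t^{(n)}:n\in\mathbb{N})$ such that $t^{(n)}\to\infty$ as $n\to\infty$ we have \[ \lim_{n\to\infty}\mathrm{d}^{(n)}(t^{(n)})=0. \] In particular, the family of processes $(\mathcal{Z}^{(n)}:n\in\mathbb{N})$ does not exhibit cut-off in the total variation distance as $n\to\infty$ (at any sequence of cut-off times).
   Context: Setting. Let $\lambda>0$, $c>0$, $\alpha\in(0,2]$, $x_0\in\mathbb{R}$ (deterministic). Let $L=(L_t:t\ge0)$ be a one-dimensional Lévy process with $\mathbb{E}[e^{izL_1}]=\exp(-c|z|^\alpha)$ for all $z\in\mathbb{R}$, and let $X=(X_t:t\ge0)$ be the unique strong solution (Ornstein–Uhlenbeck process) of \[ \mathrm{d}X_t=-\lambda X_t\,\mathrm{d}t+\mathrm{d}L_t\ (t\ge 0),\qquad X_0=x_0 . \] As $t\to\infty$, $X_t$ converges in distribution to a random variable $X_\infty$ having the law of $(1/(\lambda\alpha))^{1/\alpha}L_1$. Let $X^{(1)},X^{(2)},\ldots$ be i.i.d. copies of the process $X$ (same $x_0$), and let $X^{(1)}_\infty,X^{(2)}_\infty,\ldots$ be i.i.d. copies of $X_\infty$. For $n\in\mathbb{N}$ set $\mathcal{Z}^{(n)}_t=\max_{1\le j\le n}X^{(j)}_t$ for $t\ge0$, $\mathcal{Z}^{(n)}=(\mathcal{Z}^{(n)}_t:t\ge0)$, and let $\mathcal{Z}^{(n)}_\infty$ have the law of $\max_{1\le j\le n}X^{(j)}_\infty$.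 For real random variables $U,V$, $\mathbf{d}_{\mathrm{TV}}(U,V)=\sup_{F}|\mathbb{P}(U\in F)-\mathbb{P}(V\in F)|$ (supremum over Borel sets $F\subset\mathbb{R}$) is the total variation distance between their laws. Define $\mathrm{d}^{(n)}(t)=\mathbf{d}_{\mathrm{TV}}(\mathcal{Z}^{(n)}_t,\mathcal{Z}^{(n)}_\infty)$ for $t>0$. Definition (cut-off). The family $(\mathcal{Z}^{(n)}:n\in\mathbb{N})$ has cut-off at $(t^{(n)}:n\in\mathbb{N})$ with cut-off time $t^{(n)}$ if $t^{(n)}\to\infty$ as $n\to\infty$ and $\lim_{n\to\infty}\mathrm{d}^{(n)}(\delta t^{(n)})$ equals $1$ for every $\delta\in(0,1)$ and equals $0$ for every $\delta\in(1,\infty)$. *)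

theory Defs
  imports "HOL-Probability.Probability"
begin

text \<open>Processes are indexed by \<^typ>\<open>real\<close>; only their values at times \<open>t \<ge> 0\<close> are constrained.\<close>

definition cadlag :: "(real \<Rightarrow> real) \<Rightarrow> bool" where
  "cadlag f \<longleftrightarrow>
     (\<forall>t\<ge>0. (f \<longlongrightarrow> f t) (at_right t)) \<and>
     (\<forall>t>0. \<exists>l. (f \<longlongrightarrow> l) (at_left t))"

definition levy_process :: "'a measure \<Rightarrow> (real \<Rightarrow> 'a \<Rightarrow> real) \<Rightarrow> bool" where
  "levy_process M L \<longleftrightarrow>
     prob_space M \<and>
     (\<forall>t\<ge>0. L t \<in> borel_measurable M) \<and>
     (AE \<omega> in M. L 0 \<omega> = 0) \<and>
     (\<forall>n t. 0 \<le> t 0 \<and> (\<forall>i<n. t i \<le> t (Suc i)) \<longrightarrow>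
        prob_space.indep_vars M (\<lambda>_. borel) (\<lambda>i \<omega>. L (t (Suc i)) \<omega> - L (t i) \<omega>) {..<n}) \<and>
     (\<forall>s\<ge>0. \<forall>h\<ge>0. distr M borel (\<lambda>\<omega>. L (s + h) \<omega> - L s \<omega>) = distr M borel (L h)) \<and>
     (AE \<omega> in M. cadlag (\<lambda>t. L t \<omega>))"

definition natural_filtration :: "'a measure \<Rightarrow> (real \<Rightarrow> 'a \<Rightarrow> real) \<Rightarrow> real \<Rightarrow> 'a measure" where
  "natural_filtration M L t =
     sigma (space M) {L s -` A \<inter> space M | s A. 0 \<le> s \<and> s \<le> t \<and> A \<in> sets borel}"

text \<open>Strong solution of \<open>dX\<^sub>t = - lam X\<^sub>t dt + dL\<^sub>t\<close>, \<open>X\<^sub>0 = x0\<close>. Since the noise is additive, the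
  equation is pathwise. The third conjunct is adaptedness to the natural filtration of the driving
  process augmented by the null sets: each \<open>X\<^sub>t\<close> agrees almost surely with a random variable that
  is measurable for the unaugmented filtration.\<close>

definition OU_strong_solution ::
  "'a measure \<Rightarrow> real \<Rightarrow> real \<Rightarrow> (real \<Rightarrow> 'a \<Rightarrow> real) \<Rightarrow> (real \<Rightarrow> 'a \<Rightarrow> real) \<Rightarrow> bool" where
  "OU_strong_solution M lam x0 L X \<longleftrightarrow>
     (\<forall>t\<ge>0. X t \<in> borel_measurable M) \<and>
     (AE \<omega> in M. cadlag (\<lambda>t. X t \<omega>)) \<and>
     (\<forall>t\<ge>0. \<exists>Y \<in> borel_measurable (natural_filtration M L t). AE \<omega> in M. X t \<omega> = Y \<omega>) \<and>
     (AE \<omega> in M. X 0 \<omega> = x0) \<and>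
     (AE \<omega> in M. \<forall>t\<ge>0. X t \<omega> = X 0 \<omega> - lam * (LINT s:{0..t}|lborel. X s \<omega>) + L t \<omega>)"

text \<open>A process as a single random element of the product space \<open>\<real>\<^bsup>[0,\<infinity>)\<^esup>\<close>.\<close>

abbreviation path_space :: "(real \<Rightarrow> real) measure" where
  "path_space \<equiv> PiM {0..} (\<lambda>_. borel)"

definition path :: "(real \<Rightarrow> 'a \<Rightarrow> real) \<Rightarrow> 'a \<Rightarrow> (real \<Rightarrow> real)" where
  "path X \<omega> = (\<lambda>t\<in>{0..}. X t \<omega>)"

text \<open>Independent copies are indexed by \<open>j \<ge> 1\<close>.\<close>

definition iid_process_copies ::
  "'b measure \<Rightarrow> (nat \<Rightarrow> real \<Rightarrow> 'b \<Rightarrow> real) \<Rightarrow> 'a measure \<Rightarrow> (real \<Rightarrow> 'a \<Rightarrow> real) \<Rightarrow> bool" where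
  "iid_process_copies N Xs M X \<longleftrightarrow>
     prob_space N \<and>
     prob_space.indep_vars N (\<lambda>_. path_space) (\<lambda>j. path (Xs j)) {1..} \<and>
     (\<forall>j\<ge>1. distr N path_space (path (Xs j)) = distr M path_space (path X))"

definition iid_copies ::
  "'b measure \<Rightarrow> (nat \<Rightarrow> 'b \<Rightarrow> real) \<Rightarrow> 'a measure \<Rightarrow> ('a \<Rightarrow> real) \<Rightarrow> bool" where
  "iid_copies P Ys M Y \<longleftrightarrow>
     prob_space P \<and>
     prob_space.indep_vars P (\<lambda>_. borel) Ys {1..} \<and>
     (\<forall>j\<ge>1. distr P borel (Ys j) = distr M borel Y)"

text \<open>The two maxima below are meaningful for \<open>n \<ge> 1\<close> only; the value at \<open>n = 0\<close> plays no role
  in the limits \<open>n \<rightarrow> \<infinity>\<close>.\<close>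

definition max_process :: "(nat \<Rightarrow> real \<Rightarrow> 'a \<Rightarrow> real) \<Rightarrow> nat \<Rightarrow> real \<Rightarrow> 'a \<Rightarrow> real" where
  "max_process Xs n t \<omega> = Max ((\<lambda>j. Xs j t \<omega>) ` {1..n})"

definition max_variable :: "(nat \<Rightarrow> 'a \<Rightarrow> real) \<Rightarrow> nat \<Rightarrow> 'a \<Rightarrow> real" where
  "max_variable Ys n \<omega> = Max ((\<lambda>j. Ys j \<omega>) ` {1..n})"

text \<open>Total variation distance between the laws of two real random variables, which may live on
  different probability spaces; there is no factor 2.\<close>

definition tv_dist :: "'a measure \<Rightarrow> ('a \<Rightarrow> real) \<Rightarrow> 'b measure \<Rightarrow> ('b \<Rightarrow> real) \<Rightarrow> real" where
  "tv_dist M U N V =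
     (SUP F\<in>sets borel. \<bar>\<P>(\<omega> in M. U \<omega> \<in> F) - \<P>(\<omega> in N. V \<omega> \<in> F)\<bar>)"

text \<open>Cut-off at \<open>tc\<close> of a family of processes \<open>Z n\<close> on \<open>N\<close> towards limit variables \<open>Zinf n\<close> on \<open>P\<close>.\<close>

definition has_cutoff ::
  "'a measure \<Rightarrow> (nat \<Rightarrow> real \<Rightarrow> 'a \<Rightarrow> real) \<Rightarrow> 'b measure \<Rightarrow> (nat \<Rightarrow> 'b \<Rightarrow> real) \<Rightarrow> (nat \<Rightarrow> real) \<Rightarrow> bool"
where
  "has_cutoff N Z P Zinf tc \<longleftrightarrow>
     filterlim tc at_top sequentially \<and>
     (\<forall>\<delta>. 0 < \<delta> \<and> \<delta> < 1 \<longrightarrow> (\<lambda>n. tv_dist N (Z n (\<delta> * tc n)) P (Zinf n)) \<longlonglongrightarrow> 1) \<and>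
     (\<forall>\<delta>. 1 < \<delta> \<longrightarrow> (\<lambda>n. tv_dist N (Z n (\<delta> * tc n)) P (Zinf n)) \<longlonglongrightarrow> 0)"

end

theory Submission
  imports Defs "HOL-Complex_Analysis.Complex_Analysis" "HOL-Real_Asymp.Real_Asymp"
begin

text \<open>
  At time \<open>t\<close> the Ornstein-Uhlenbeck process has the law of \<open>m + r * Y\<close>, where \<open>Y\<close> is distributed like
  \<open>X\<^sub>\<infinity>\<close>, \<open>m = exp (- lam * t) * x0\<close> and \<open>r = (1 - exp (- lam * \<alpha> * t)) powr (1 / \<alpha>)\<close> (lemma \<open>OU_law\<close>). So
  the question is how much the law of the maximum of \<open>n\<close> independent copies of \<open>Y\<close> changes when each copy is
  replaced by \<open>m + r * Y\<close> with \<open>m\<close> near \<open>0\<close> and \<open>r\<close> near \<open>1\<close>, uniformly in \<open>n\<close>.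

  The maximum is governed by the far right tail of the common density. For \<open>\<alpha> < 2\<close> the density \<open>f\<close> of \<open>Y\<close>
  satisfies \<open>f x \<sim> \<kappa> * x powr (- 1 - \<alpha>)\<close> with \<open>\<kappa> > 0\<close> (lemma \<open>stable_density\<close>), so the density of
  \<open>m + r * Y\<close> differs from \<open>f\<close> by a small relative error, uniformly beyond some point \<open>K\<close> (lemma
  \<open>tail_density_affine_stable\<close>). A relative error \<open>\<epsilon>\<close> in the tail of the density changes the law of the
  maximum by at most \<open>2 * \<epsilon>\<close> in total variation, whatever \<open>n\<close> is, apart from the event that the maximum is
  below \<open>K\<close>, whose probability tends to \<open>0\<close> (lemma \<open>max_law_close\<close>). Hence the distance tends to \<open>0\<close> along
  every sequence of times that tends to infinity. A cut-off at \<open>tc\<close> would require the limit \<open>1\<close> along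
  \<open>tc / 2\<close>, which is such a sequence.

  The tail of \<open>f\<close> comes from the Fourier inversion integral: rotating the half line by \<open>pi / 4\<close> in the
  complex plane replaces oscillation by exponential decay, after which dominated convergence applies
  (lemmas \<open>ray_rotation\<close> and \<open>stable_integral_tail\<close>). The law of \<open>X\<^sub>t\<close> is found from the characteristic
  functions of Riemann sums that approximate the stochastic convolution of the exponential with the
  noise (lemmas \<open>OU_discretized_noise\<close> and \<open>OU_char\<close>).
\<close>


section \<open>Rotating a complex integral to another ray\<close>

text \<open>A holomorphic function on the right half plane has a primitive there, so its integrals along two
  truncated rays differ by the integrals over two circular arcs. The bound \<open>B\<close> on the modulus makes
  the arcs vanish at \<open>0\<close> and at infinity (arc length times \<open>B r\<close> tends to \<open>0\<close>) and also dominates the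
  integrands on the rays.\<close>

lemma ray_rotation:
  fixes g :: "complex \<Rightarrow> complex" and \<theta> :: real and B :: "real \<Rightarrow> real"
  assumes holo: "g holomorphic_on {z. Re z > 0}" and \<theta>: "\<bar>\<theta>\<bar> < pi / 2"
    and bound: "\<And>r t. r > 0 \<Longrightarrow> t \<in> closed_segment 0 \<theta> \<Longrightarrow> norm (g (rcis r t)) \<le> B r"
    and B_0: "((\<lambda>r. r * B r) \<longlongrightarrow> 0) (at_right 0)"
    and B_inf: "((\<lambda>r. r * B r) \<longlongrightarrow> 0) at_top"
    and B_int: "set_integrable lborel {0<..} B"
  shows "(LINT r:{0<..}|lborel. g (complex_of_real r)) = (LINT r:{0<..}|lborel. g (rcis r \<theta>) * cis \<theta>)"
proof -
  define H where "H = {z::complex. Re z > 0}"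
  have H: "open H" "convex H"
    unfolding H_def by (auto simp: open_halfspace_Re_gt convex_halfspace_Re_gt)
  obtain G where G: "\<And>z. z \<in> H \<Longrightarrow> (G has_field_derivative g z) (at z within H)"
    using holomorphic_convex_primitive'[OF H(2,1) holo[folded H_def]] by metis
  have G': "(G has_field_derivative g z) (at z)" if "z \<in> H" for z
    using G[OF that] by (simp only: at_within_open[OF that H(1)])
  have in_H: "rcis r t \<in> H" if "r > 0" "t \<in> closed_segment 0 \<theta>" for r t
  proof -
    have "\<bar>t\<bar> < pi / 2"
      using that(2) \<theta> by (auto simp: closed_segment_eq_real_ivl split: if_splits)
    then have "cos t > 0"
      by (intro cos_gt_zero_pi) auto
    with that show ?thesis by (simp add: H_def)
  qed
  have contg: "continuous_on H g"
    using holo unfolding H_def by (rule holomorphic_on_imp_continuous_on)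
  define a b :: "nat \<Rightarrow> real" where "a = (\<lambda>n. 1 / Suc n)" and "b = (\<lambda>n. real (Suc n))"
  have ab: "0 < a n" "0 < b n" "a n \<le> b n" for n
    using order_trans[of "1 / real (Suc n)" 1 "real (Suc n)"] by (simp_all add: a_def b_def)
  have a_lim: "filterlim a (at_right 0) sequentially"
    unfolding a_def by real_asymp
  have b_lim: "filterlim b at_top sequentially"
    unfolding b_def by real_asymp
  \<comment> \<open>The truncated integral over \<open>[a n, b n]\<close> is an increment of the primitive \<open>G\<close> along the ray.\<close>
  have ray: "(\<lambda>n. G (rcis (b n) t) - G (rcis (a n) t)) \<longlonglongrightarrow>
      (LINT r:{0<..}|lborel. g (rcis r t) * cis t)" if t: "t \<in> closed_segment 0 \<theta>" for t
  proof -
    have deriv: "((\<lambda>r. G (rcis r t)) has_vector_derivative (g (rcis r t) * cis t)) (at r within S)"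
      if "r > 0" for r S
    proof -
      have "((\<lambda>r. rcis r t) has_vector_derivative cis t) (at r within S)"
        unfolding rcis_def by (auto intro!: derivative_eq_intros)
      from field_vector_diff_chain_within[OF this DERIV_subset[OF G'[OF in_H[OF that t]] subset_UNIV]]
      show ?thesis by (simp add: o_def mult.commute)
    qed
    have cont: "continuous_on {0<..} (\<lambda>r. g (rcis r t) * cis t)"
      by (intro continuous_intros continuous_on_compose2[OF contg]) 
         (auto simp: rcis_def intro!: continuous_intros in_H[unfolded rcis_def] t)
    have meas: "(\<lambda>r. indicator {0<..} r *\<^sub>R (g (rcis r t) * cis t)) \<in> borel_measurable borel"
      using borel_measurable_continuous_on_indicator[OF _ cont] by simp
    have eq: "(LBINT r. indicator {a n..b n} r *\<^sub>R (g (rcis r t) * cis t))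
        = G (rcis (b n) t) - G (rcis (a n) t)" for n
      using ab[of n] by (intro integral_FTC_Icc deriv continuous_on_subset[OF cont]) auto
    have "(\<lambda>n. LBINT r. indicator {a n..b n} r *\<^sub>R (g (rcis r t) * cis t)) \<longlonglongrightarrow>
      (LBINT r. indicator {0<..} r *\<^sub>R (g (rcis r t) * cis t))"
    proof (rule integral_dominated_convergence[where w = "\<lambda>r. indicator {0<..} r *\<^sub>R B r"])
      show "integrable lborel (\<lambda>r. indicator {0<..} r *\<^sub>R B r)"
        using B_int unfolding set_integrable_def .
      show "AE r in lborel. (\<lambda>n. indicator {a n..b n} r *\<^sub>R (g (rcis r t) * cis t)) \<longlonglongrightarrow>
          indicator {0<..} r *\<^sub>R (g (rcis r t) * cis t)"
      proof (rule AE_I2)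
        fix r :: real
        show "(\<lambda>n. indicator {a n..b n} r *\<^sub>R (g (rcis r t) * cis t)) \<longlonglongrightarrow>
          indicator {0<..} r *\<^sub>R (g (rcis r t) * cis t)"
        proof (cases "r > 0")
          case True
          have "eventually (\<lambda>n. a n < r) sequentially"
            using a_lim True by (auto simp: filterlim_at intro: order_tendstoD)
          moreover have "eventually (\<lambda>n. r \<le> b n) sequentially"
            using b_lim by (simp add: filterlim_at_top)
          ultimately have "eventually (\<lambda>n. indicator {a n..b n} r *\<^sub>R (g (rcis r t) * cis t) =
              indicator {0<..} r *\<^sub>R (g (rcis r t) * cis t)) sequentially"
            by eventually_elim (use True in auto)
          then show ?thesis by (rule tendsto_eventually)
        next
          case False
          then have "indicator {a n..b n} r = (0::real)" for n
            using ab[of n] by (auto simp: indicator_def)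
          then show ?thesis using False by simp
        qed
      qed
      show "(\<lambda>r. indicator {0<..} r *\<^sub>R (g (rcis r t) * cis t)) \<in> borel_measurable lborel"
        using meas by simp
      have "(\<lambda>r. indicator {a n..b n} r *\<^sub>R (g (rcis r t) * cis t)) \<in> borel_measurable borel" for n
        using ab[of n] by (intro borel_measurable_continuous_on_indicator continuous_on_subset[OF cont]) auto
      then show "(\<lambda>r. indicator {a n..b n} r *\<^sub>R (g (rcis r t) * cis t)) \<in> borel_measurable lborel" for n
        by simp
      show "AE r in lborel. norm (indicator {a n..b n} r *\<^sub>R (g (rcis r t) * cis t))
          \<le> indicator {0<..} r *\<^sub>R B r" for n
      proof (rule AE_I2)
        fix r :: real
        show "norm (indicator {a n..b n} r *\<^sub>R (g (rcis r t) * cis t)) \<le> indicator {0<..} r *\<^sub>R B r"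
          using bound[of r t] t ab[of n] order_trans[OF norm_ge_zero bound[of r t]]
          by (auto simp: indicator_def norm_mult)
      qed
    qed
    then show ?thesis by (simp only: eq set_lebesgue_integral_def)
  qed
  have arc: "norm (G (rcis r \<theta>) - G (rcis r 0)) \<le> r * B r * \<bar>\<theta>\<bar>" if r: "r > 0" for r
  proof -
    define p where "p = part_circlepath 0 r 0 \<theta>"
    have img: "path_image p \<subseteq> H" and img': "\<And>z. z \<in> path_image p \<Longrightarrow> norm (g z) \<le> B r"
      using in_H[OF r] bound[OF r]
      by (auto simp: p_def path_image_part_circlepath' rcis_def cis_conv_exp)
    have "(g has_contour_integral (G (pathfinish p) - G (pathstart p))) p"
      by (rule contour_integral_primitive[OF G _ img]) (simp_all add: p_def)
    moreover have "pathfinish p = rcis r \<theta>" "pathstart p = rcis r 0"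
      by (simp_all add: p_def rcis_def cis_conv_exp)
    ultimately have ci: "(g has_contour_integral (G (rcis r \<theta>) - G (rcis r 0))) p" by simp
    have "norm (contour_integral p g) \<le> B r * r * \<bar>\<theta> - 0\<bar>"
      unfolding p_def
      by (rule contour_integral_bound_part_circlepath)
         (use ci img' r order_trans[OF norm_ge_zero bound[OF r, of 0]] in
           \<open>auto simp: p_def[symmetric] contour_integrable_on_def\<close>)
    then show ?thesis
      using contour_integral_unique[OF ci] by (simp add: mult.commute)
  qed
  have to0: "(\<lambda>n. G (rcis (s n) \<theta>) - G (rcis (s n) 0)) \<longlonglongrightarrow> 0"
    if s: "\<And>n. s n > 0" and lim: "(\<lambda>n. s n * B (s n)) \<longlonglongrightarrow> 0" for s :: "nat \<Rightarrow> real"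
  proof (rule Lim_null_comparison)
    show "\<forall>\<^sub>F n in sequentially. norm (G (rcis (s n) \<theta>) - G (rcis (s n) 0)) \<le> s n * B (s n) * \<bar>\<theta>\<bar>"
      using arc[OF s] by (intro always_eventually) blast
    show "(\<lambda>n. s n * B (s n) * \<bar>\<theta>\<bar>) \<longlonglongrightarrow> 0"
      using tendsto_mult_left_zero[OF lim] by simp
  qed
  have "(\<lambda>n. (G (rcis (b n) \<theta>) - G (rcis (a n) \<theta>)) - (G (rcis (b n) 0) - G (rcis (a n) 0))) \<longlonglongrightarrow> 0"
    using tendsto_diff[OF to0[of b, OF ab(2) filterlim_compose[OF B_inf b_lim]]
        to0[of a, OF ab(1) filterlim_compose[OF B_0 a_lim]]]
    by (simp add: algebra_simps)
  moreover have "(\<lambda>n. (G (rcis (b n) \<theta>) - G (rcis (a n) \<theta>)) - (G (rcis (b n) 0) - G (rcis (a n) 0))) \<longlonglongrightarrow>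
    (LINT r:{0<..}|lborel. g (rcis r \<theta>) * cis \<theta>) - (LINT r:{0<..}|lborel. g (rcis r 0) * cis 0)"
    by (intro tendsto_diff ray) auto
  ultimately have "(LINT r:{0<..}|lborel. g (rcis r \<theta>) * cis \<theta>) - (LINT r:{0<..}|lborel. g (rcis r 0) * cis 0) = 0"
    using LIMSEQ_unique by blast
  then show ?thesis by (simp add: rcis_def)
qed

lemma Ln_rcis:
  assumes "r > 0" "\<bar>t\<bar> < pi"
  shows "Ln (rcis r t) = of_real (ln r) + \<i> * of_real t"
  by (rule Ln_unique) (use assms in \<open>auto simp: rcis_def exp_add cis_conv_exp exp_of_real\<close>)

lemma rcis_powr_real:
  assumes "r > 0" "\<bar>t\<bar> < pi"
  shows "rcis r t powr complex_of_real p = of_real (r powr p) * cis (p * t)"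
proof -
  have "rcis r t \<noteq> 0" using assms by (simp add: rcis_def)
  then show ?thesis
    using assms by (simp add: powr_def Ln_rcis cis_conv_exp exp_of_real ring_distribs exp_add mult_ac flip: of_real_mult)
qed

text \<open>A continuous function that is \<open>o(r\<^sup>-\<^sup>2)\<close> is bounded by a multiple of \<open>1 / (1 + r\<^sup>2)\<close>.\<close>

lemma set_integrable_of_decay:
  fixes h :: "real \<Rightarrow> real"
  assumes cont: "continuous_on {0..} h" and decay: "((\<lambda>r. r\<^sup>2 * h r) \<longlongrightarrow> 0) at_top"
  shows "set_integrable lborel {0<..} h"
proof -
  have "((\<lambda>r. inverse (r\<^sup>2)) \<longlongrightarrow> (0::real)) at_top"
    by real_asymp
  from tendsto_mult[OF decay this] have "((\<lambda>r. r\<^sup>2 * h r * inverse (r\<^sup>2)) \<longlongrightarrow> 0) at_top" by simp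
  moreover have "\<forall>\<^sub>F r in at_top. r\<^sup>2 * h r * inverse (r\<^sup>2) = h r"
    using eventually_gt_at_top[of 0] by eventually_elim (simp add: field_simps)
  ultimately have "(h \<longlongrightarrow> 0) at_top" by (rule Lim_transform_eventually)
  from tendsto_add[OF this decay] have "((\<lambda>r. (1 + r\<^sup>2) * h r) \<longlongrightarrow> 0) at_top"
    by (simp add: algebra_simps)
  then have "\<forall>\<^sub>F r in at_top. \<bar>(1 + r\<^sup>2) * h r\<bar> < 1"
    by (auto simp: tendsto_iff dist_real_def dest: spec[of _ 1])
  then obtain R where R: "\<And>r. r \<ge> R \<Longrightarrow> \<bar>(1 + r\<^sup>2) * h r\<bar> < 1"
    by (auto simp: eventually_at_top_linorder)
  have "continuous_on {0..max R 0} (\<lambda>r. (1 + r\<^sup>2) * h r)"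
    by (intro continuous_intros continuous_on_subset[OF cont]) auto
  then have "bounded ((\<lambda>r. (1 + r\<^sup>2) * h r) ` {0..max R 0})"
    by (intro compact_imp_bounded compact_continuous_image) auto
  then obtain C where C: "\<forall>r\<in>{0..max R 0}. \<bar>(1 + r\<^sup>2) * h r\<bar> \<le> C"
    unfolding bounded_iff by auto
  have bd: "\<bar>h r\<bar> \<le> max C 1 * (1 / (1 + r\<^sup>2))" if "r > 0" for r
  proof -
    have "\<bar>(1 + r\<^sup>2) * h r\<bar> \<le> max C 1"
      using C R[of r] that by (cases "r \<ge> R") (auto simp: less_imp_le le_max_iff_disj)
    moreover have "1 + r\<^sup>2 > 0" by (simp add: add_pos_nonneg)
    ultimately show ?thesis by (simp add: abs_mult field_simps)
  qed
  have meas: "(\<lambda>r. indicator {0<..} r *\<^sub>R h r) \<in> borel_measurable borel"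
    by (intro borel_measurable_continuous_on_indicator continuous_on_subset[OF cont]) auto
  have "set_integrable lborel {0<..} (\<lambda>r. max C 1 * (1 / (1 + r\<^sup>2)))"
    using integrable_I0i_1_div_plus_square
    by (intro set_integrable_mult_right)
       (simp add: interval_lebesgue_integrable_def zero_ereal_def)
  then show ?thesis
    unfolding set_integrable_def
    by (rule Bochner_Integration.integrable_bound)
       (use meas bd in \<open>auto simp: indicator_def\<close>)
qed

lemma set_integrable_powr_exp:
  fixes p q k :: real
  assumes "k > 0" "q > 0" "p \<ge> 0"
  shows "set_integrable lborel {0<..} (\<lambda>r. r powr p * exp (- k * r powr q))"
proof (cases "p = 0")
  case False
  have "((\<lambda>r. r\<^sup>2 * (r powr p * exp (- k * r powr q))) \<longlongrightarrow> 0) at_top"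
    using assms by real_asymp
  then show ?thesis
    using assms False
    by (intro set_integrable_of_decay continuous_intros continuous_on_powr') auto
next
  case True
  have "((\<lambda>r. r\<^sup>2 * exp (- k * r powr q)) \<longlongrightarrow> 0) at_top"
    using assms by real_asymp
  then have "set_integrable lborel {0<..} (\<lambda>r. exp (- k * r powr q))"
    using assms
    by (intro set_integrable_of_decay continuous_intros continuous_on_powr') auto
  also have "?this \<longleftrightarrow> ?thesis"
    by (intro set_integrable_cong) (auto simp: True)
  finally show ?thesis .
qed

lemma times_powr_exp_limits:
  fixes p q k :: real
  assumes "k > 0" "q > 0" "p \<ge> 0"
  shows "((\<lambda>r. r * (r powr p * exp (- k * r powr q))) \<longlongrightarrow> 0) (at_right 0)"
    and "((\<lambda>r. r * (r powr p * exp (- k * r powr q))) \<longlongrightarrow> 0) at_top"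
proof -
  show "((\<lambda>r. r * (r powr p * exp (- k * r powr q))) \<longlongrightarrow> 0) at_top"
    using assms by real_asymp
  show "((\<lambda>r. r * (r powr p * exp (- k * r powr q))) \<longlongrightarrow> 0) (at_right 0)"
  proof (rule Lim_null_comparison)
    show "\<forall>\<^sub>F r in at_right 0. norm (r * (r powr p * exp (- k * r powr q))) \<le> r"
    proof (rule eventually_mono[OF eventually_at_right_real[OF zero_less_one]])
      fix r :: real assume "r \<in> {0<..<1}"
      then have r: "0 < r" "r < 1" by auto
      have "r powr p \<le> 1 powr p" using r assms by (intro powr_mono2) auto
      moreover have "exp (- k * r powr q) \<le> 1" using assms r by simp
      ultimately have "r powr p * exp (- k * r powr q) \<le> 1 * 1"
        by (intro mult_mono) auto
      then show "norm (r * (r powr p * exp (- k * r powr q))) \<le> r"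
        using r by (simp add: abs_mult mult_left_le)
    qed
    show "((\<lambda>r. r) \<longlongrightarrow> 0) (at_right (0::real))" by (rule tendsto_ident_at)
  qed
qed

lemma holomorphic_powr_right_half_plane:
  "(\<lambda>z. z powr w) holomorphic_on {z. Re z > 0}"
  by (intro holomorphic_intros) (auto simp: complex_nonpos_Reals_iff)

text \<open>Euler's integral of \<open>z powr p * exp (- z)\<close>, rotated from the positive axis to the ray of angle
  \<open>- pi / 4\<close>; on that ray \<open>- z = \<i> * u * cis (pi / 4)\<close>, which is the exponent that a Fourier integral
  acquires on the ray of angle \<open>pi / 4\<close>. Taking \<open>p = 0\<close> evaluates the integral of the exponential itself.\<close>

lemma Gamma_rotated_ray:
  fixes p :: real
  assumes p: "p \<ge> 0"
  shows "(LINT u:{0<..}|lborel. u powr p *\<^sub>R exp (\<i> * u * cis (pi / 4)))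
       = Gamma (1 + p) * cis (pi * (1 + p) / 4)"
proof -
  define g where "g = (\<lambda>z::complex. z powr of_real p * exp (- z))"
  define \<psi> where "\<psi> = - (pi / 4)"
  define k where "k = cos (pi / 4)"
  have k: "k > 0" by (simp add: k_def cos_45)
  have "(LINT r:{0<..}|lborel. g (complex_of_real r)) = (LINT r:{0<..}|lborel. g (rcis r \<psi>) * cis \<psi>)"
  proof (rule ray_rotation[where B = "\<lambda>r. r powr p * exp (- k * r powr 1)"])
    show "g holomorphic_on {z. Re z > 0}"
      unfolding g_def by (intro holomorphic_intros holomorphic_powr_right_half_plane)
    show "\<bar>\<psi>\<bar> < pi / 2" by (simp add: \<psi>_def)
    fix r t :: real assume r: "r > 0" and t: "t \<in> closed_segment 0 \<psi>"
    have t': "\<bar>t\<bar> \<le> pi / 4"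
      using t by (auto simp: \<psi>_def closed_segment_eq_real_ivl split: if_splits)
    then have t_pi: "\<bar>t\<bar> < pi" using pi_gt_zero by linarith
    \<comment> \<open>In the sector \<open>Re z \<ge> k * norm z\<close>.\<close>
    have "k \<le> cos \<bar>t\<bar>" unfolding k_def using t' by (intro cos_monotone_0_pi_le) auto
    then have "r * k \<le> r * cos t" using r by simp
    then show "norm (g (rcis r t)) \<le> r powr p * exp (- k * r powr 1)"
      using r t_pi unfolding g_def
      by (subst rcis_powr_real) (auto simp: norm_mult mult_ac)
  qed (rule times_powr_exp_limits set_integrable_powr_exp; use k p in simp)+
  moreover have "(LINT r:{0<..}|lborel. g (complex_of_real r)) = Gamma (1 + p)"
  proof -
    have int: "(\<lambda>t. complex_of_real t powr (complex_of_real (1 + p) - 1) / of_real (exp t)) absolutely_integrable_on {0<..}"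
      by (rule absolutely_integrable_Gamma_integral') (use p in auto)
    have hi: "((\<lambda>t. complex_of_real t powr (complex_of_real (1 + p) - 1) / of_real (exp t)) has_integral Gamma (complex_of_real (1 + p))) {0<..}"
      by (rule Gamma_integral_complex') (use p in auto)
    have eq: "complex_of_real t powr (complex_of_real (1 + p) - 1) / of_real (exp t) = g t" for t
      by (simp add: g_def exp_minus field_simps exp_of_real)
    have contg: "continuous_on {0<..} (\<lambda>t::real. g (of_real t))"
      unfolding g_def by (intro continuous_intros) (auto simp: complex_nonpos_Reals_iff)
    have meas: "(\<lambda>t. indicator {0<..} t *\<^sub>R g (complex_of_real t)) \<in> borel_measurable borel"
      by (rule borel_measurable_continuous_on_indicator) (auto intro: contg)
    have "set_integrable lborel {0<..} (\<lambda>t. g (complex_of_real t))"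
      using int meas unfolding eq set_integrable_def by (simp add: integrable_completion)
    then have "(LINT r:{0<..}|lborel. g (complex_of_real r)) = integral {0<..} (\<lambda>t. g (complex_of_real t))"
      by (rule set_borel_integral_eq_integral(2))
    also have "\<dots> = Gamma (complex_of_real (1 + p))"
      using hi unfolding eq by (rule integral_unique)
    finally show ?thesis by (simp only: Gamma_complex_of_real)
  qed
  moreover have "(LINT r:{0<..}|lborel. g (rcis r \<psi>) * cis \<psi>) =
      (LINT r:{0<..}|lborel. cis (\<psi> * (1 + p)) * (r powr p *\<^sub>R exp (\<i> * r * cis (pi / 4))))"
  proof (rule set_lebesgue_integral_cong)
    show "\<forall>r. r \<in> {0<..} \<longrightarrow> g (rcis r \<psi>) * cis \<psi> = cis (\<psi> * (1 + p)) * (r powr p *\<^sub>R exp (\<i> * r * cis (pi / 4)))"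
    proof (intro allI impI)
      fix r :: real assume "r \<in> {0<..}"
      then have r: "r > 0" by simp
      have "\<i> * cis (pi / 4) = - cis \<psi>"
        by (simp add: \<psi>_def complex_eq_iff sin_45 cos_45)
      have "- rcis r \<psi> = r * (\<i> * cis (pi / 4))"
        unfolding \<open>\<i> * cis (pi / 4) = - cis \<psi>\<close> by (simp add: rcis_def)
      then have e: "- rcis r \<psi> = \<i> * r * cis (pi / 4)" by (simp add: mult_ac)
      have "g (rcis r \<psi>) = of_real (r powr p) * cis (p * \<psi>) * exp (\<i> * r * cis (pi / 4))"
        unfolding g_def e using r by (subst rcis_powr_real) (auto simp: \<psi>_def)
      then show "g (rcis r \<psi>) * cis \<psi> = cis (\<psi> * (1 + p)) * (r powr p *\<^sub>R exp (\<i> * r * cis (pi / 4)))"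
        by (simp add: scaleR_conv_of_real distrib_left mult_ac flip: cis_mult)
    qed
  qed simp
  ultimately have "cis (\<psi> * (1 + p)) * (LINT u:{0<..}|lborel. u powr p *\<^sub>R exp (\<i> * u * cis (pi / 4))) = Gamma (1 + p)"
    by (simp only: set_integral_mult_right)
  then have "cis (- \<psi> * (1 + p)) * cis (\<psi> * (1 + p)) * (LINT u:{0<..}|lborel. u powr p *\<^sub>R exp (\<i> * u * cis (pi / 4)))
       = cis (- \<psi> * (1 + p)) * Gamma (1 + p)"
    by (simp only: mult.assoc)
  then show ?thesis by (simp add: cis_mult \<psi>_def mult_ac)
qed

section \<open>Density of the symmetric stable law and its tail\<close>

text \<open>Because the characteristic function is integrable, the principal value in Levy's inversion formula is
  an absolutely convergent integral. The formula then bounds the mass of an interval by a multiple of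
  its length, which excludes atoms, so it holds for all pairs of end points and its difference quotient
  may be passed to the limit under the integral.\<close>

lemma (in real_distribution) cdf_has_density_of_integrable_char:
  assumes int: "integrable lborel (char M)"
  shows "(cdf M has_real_derivative
           Re (CLBINT t. iexp (- (t * x)) * char M t) / (2 * pi)) (at x)"
proof -
  define K where "K = (\<lambda>a b t. (iexp (- (t * a)) - iexp (- (t * b))) / (\<i> * complex_of_real t) * char M t)"
  have K_meas [measurable]: "K a b \<in> borel_measurable lborel" for a b
    unfolding K_def by measurable
  have K_bound: "norm (K a b t) \<le> \<bar>b - a\<bar> * norm (char M t)" for a b t
  proof (cases "t = 0")
    case False
    have "norm ((iexp (- (t * a)) - iexp (- (t * b))) / (\<i> * complex_of_real t)) \<le> \<bar>b - a\<bar>"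
      using Levy_Inversion_aux2[of "-b" "-a" t] Levy_Inversion_aux2[of "-a" "-b" t] False
      by (cases "a \<le> b") (auto simp: norm_divide norm_minus_commute)
    then show ?thesis unfolding K_def norm_mult by (intro mult_right_mono) auto
  qed (simp add: K_def)
  have K_int: "integrable lborel (K a b)" for a b
    by (rule Bochner_Integration.integrable_bound[OF integrable_mult_right[OF integrable_norm[OF int], of "\<bar>b - a\<bar>"]])
       (auto simp: K_bound)
  have inv: "complex_of_real (measure M {a<..b}) = 1 / (2 * pi) * (CLBINT t. K a b t)"
    if "a \<le> b" "measure M {a} = 0" "measure M {b} = 0" for a b
  proof -
    have "(\<lambda>T::nat. CLBINT t=-T..T. K a b t) \<longlonglongrightarrow> (CLBINT t. K a b t)"
    proof -
      have "(\<lambda>T::nat. CLBINT t. indicator {-real T<..<real T} t *\<^sub>R K a b t) \<longlonglongrightarrow> (CLBINT t. K a b t)"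
      proof (rule integral_dominated_convergence[where w = "\<lambda>t. norm (K a b t)"])
        show "integrable lborel (\<lambda>t. norm (K a b t))" using K_int by simp
        show "AE t in lborel. (\<lambda>T::nat. indicator {-real T<..<real T} t *\<^sub>R K a b t) \<longlonglongrightarrow> K a b t"
        proof (rule AE_I2, rule tendsto_eventually)
          fix t :: real
          obtain m :: nat where "\<bar>t\<bar> < m" using reals_Archimedean2 by blast
          then show "\<forall>\<^sub>F T::nat in sequentially. indicator {-real T<..<real T} t *\<^sub>R K a b t = K a b t"
            by (intro eventually_sequentiallyI[of m]) (auto simp: indicator_def)
        qed
      qed (auto split: split_indicator)
      then show ?thesis
        by (simp add: interval_lebesgue_integral_def set_lebesgue_integral_def)
    qed
    then have "(\<lambda>T::nat. 1 / (2 * pi) * (CLBINT t=-T..T. K a b t)) \<longlonglongrightarrow> 1 / (2 * pi) * (CLBINT t. K a b t)"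
      by (intro tendsto_intros) auto
    with Levy_Inversion[OF that] show ?thesis
      unfolding K_def by (rule LIMSEQ_unique)
  qed
  define C where "C = (LBINT t. norm (char M t))"
  have inv_le: "measure M {a<..b} \<le> C * (b - a)"
    if "a \<le> b" "measure M {a} = 0" "measure M {b} = 0" for a b
  proof -
    have "measure M {a<..b} = norm (1 / (2 * pi) * (CLBINT t. K a b t))"
      using inv[OF that, symmetric] by simp
    also have "\<dots> = 1 / (2 * pi) * norm (CLBINT t. K a b t)"
      by (simp add: norm_mult norm_divide)
    also have "\<dots> \<le> 1 * norm (CLBINT t. K a b t)"
      using pi_gt3 by (intro mult_right_mono) (auto simp: field_simps)
    also have "\<dots> \<le> (LBINT t. norm (K a b t))"
      using integral_norm_bound by simp
    also have "\<dots> \<le> (LBINT t. \<bar>b - a\<bar> * norm (char M t))"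
      using K_int int K_bound by (intro integral_mono) auto
    also have "\<dots> = C * (b - a)" using that by (simp add: C_def)
    finally show ?thesis .
  qed
  have C0: "C \<ge> 0" unfolding C_def by simp
  have count: "countable {x. measure M {x} \<noteq> 0}" by (rule countable_support)
  \<comment> \<open>The end points of the intervals around \<open>x\<close> must themselves carry no mass; all but countably many points qualify.\<close>
  have no_atom: "measure M {x} = 0" for x
  proof (rule ccontr)
    assume "measure M {x} \<noteq> 0"
    then have pos: "measure M {x} > 0" by (simp add: zero_less_measure_iff)
    define e where "e = measure M {x} / (2 * (C + 1))"
    have e: "e > 0" using pos C0 by (simp add: e_def)
    obtain a where a: "a \<in> {x - e<..<x}" "measure M {a} = 0"
      using open_minus_countable[OF count, of "{x - e<..<x}"] e by auto
    obtain b where b: "b \<in> {x<..<x + e}" "measure M {b} = 0"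
      using open_minus_countable[OF count, of "{x<..<x + e}"] e by auto
    have "measure M {x} \<le> measure M {a<..b}"
      using a b by (intro finite_measure_mono) auto
    also have "\<dots> \<le> C * (b - a)" using a b by (intro inv_le) auto
    also have "\<dots> \<le> C * (2 * e)" using a b C0 by (intro mult_left_mono) auto
    also have "\<dots> < measure M {x}"
      using pos C0 by (simp add: e_def field_simps)
    finally show False by simp
  qed
  have cdf_diff: "complex_of_real (cdf M b - cdf M a) = 1 / (2 * pi) * (CLBINT t. K a b t)" for a b
  proof -
    have *: "complex_of_real (cdf M b - cdf M a) = 1 / (2 * pi) * (CLBINT t. K a b t)" if "a < b" for a b
      using inv[of a b] that no_atom cdf_diff_eq[OF that] by simp
    have "K b a t = - K a b t" for t
      unfolding K_def by (metis minus_diff_eq minus_divide_left mult_minus_left)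
    then have "(CLBINT t. K b a t) = - (CLBINT t. K a b t)" by simp
    show ?thesis
    proof (cases a b rule: linorder_cases)
      case greater
      have "complex_of_real (cdf M b - cdf M a) = - complex_of_real (cdf M a - cdf M b)" by simp
      also have "\<dots> = 1 / (2 * pi) * (CLBINT t. K a b t)"
        unfolding *[OF greater] \<open>(CLBINT t. K b a t) = - (CLBINT t. K a b t)\<close> by simp
      finally show ?thesis .
    next
      case less
      then show ?thesis by (rule *)
    qed (simp add: K_def)
  qed
  define f where "f = (CLBINT t. iexp (- (t * x)) * char M t)"
  have "((\<lambda>h. (cdf M (x + h) - cdf M x) / h) \<longlongrightarrow> Re f / (2 * pi)) (at 0)"
    unfolding tendsto_at_iff_sequentially
  proof (intro allI impI)
    fix h :: "nat \<Rightarrow> real" assume h: "\<forall>i. h i \<in> UNIV - {0}" "h \<longlonglongrightarrow> 0"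
    have "(\<lambda>n. CLBINT t. K x (x + h n) t / h n) \<longlonglongrightarrow> f"
      unfolding f_def
    proof (rule integral_dominated_convergence[where w = "\<lambda>t. norm (char M t)"])
      show "integrable lborel (\<lambda>t. norm (char M t))" using int by simp
      show "AE t in lborel. norm (K x (x + h n) t / complex_of_real (h n)) \<le> norm (char M t)" for n
        using K_bound[of x "x + h n"] h(1) by (auto simp: norm_divide field_simps)
      show "AE t in lborel. (\<lambda>n. K x (x + h n) t / complex_of_real (h n)) \<longlonglongrightarrow> iexp (- (t * x)) * char M t"
      proof (rule AE_I[of _ _ "{0}"])
        show "{t \<in> space lborel. \<not> (\<lambda>n. K x (x + h n) t / complex_of_real (h n)) \<longlonglongrightarrow> iexp (- (t * x)) * char M t} \<subseteq> {0}"
        proof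
          fix t :: real
          assume "t \<in> {t \<in> space lborel. \<not> (\<lambda>n. K x (x + h n) t / complex_of_real (h n)) \<longlonglongrightarrow> iexp (- (t * x)) * char M t}"
          moreover have "(\<lambda>n. K x (x + h n) t / complex_of_real (h n)) \<longlonglongrightarrow> iexp (- (t * x)) * char M t" if t: "t \<noteq> 0"
          proof -
            define w where "w = (\<lambda>n. - (\<i> * complex_of_real t * complex_of_real (h n)))"
            have "((\<lambda>w::complex. (exp w - 1) / w) \<longlongrightarrow> 1) (at 0)"
              using DERIV_exp[of "0::complex"] by (simp add: DERIV_def)
            moreover have "w \<longlonglongrightarrow> - (\<i> * complex_of_real t * complex_of_real 0)"
              unfolding w_def by (intro tendsto_intros h)
            then have "filterlim w (at 0) sequentially"
              using h(1) t by (auto simp: filterlim_at w_def)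
            ultimately have "(\<lambda>n. (exp (w n) - 1) / w n) \<longlonglongrightarrow> 1"
              by (rule filterlim_compose)
            then have "(\<lambda>n. iexp (- (t * x)) * char M t * ((exp (w n) - 1) / w n)) \<longlonglongrightarrow> iexp (- (t * x)) * char M t * 1"
              by (intro tendsto_intros)
            moreover have "iexp (- (t * x)) * char M t * ((exp (w n) - 1) / w n) = K x (x + h n) t / complex_of_real (h n)" for n
            proof -
              have "iexp (- (t * (x + h n))) = iexp (- (t * x)) * exp (w n)"
                unfolding exp_add[symmetric] w_def by (rule arg_cong[where f = exp]) (simp add: algebra_simps)
              moreover have "h n \<noteq> 0" using h(1) by auto
              ultimately show ?thesis using t unfolding K_def
                by (simp add: w_def divide_simps) (simp add: algebra_simps)
            qed
            ultimately show ?thesis by simp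
          qed
          ultimately show "t \<in> {0}" by auto
        qed
      qed auto
    qed auto
    then have "(\<lambda>n. Re ((CLBINT t. K x (x + h n) t / h n) / (2 * pi))) \<longlonglongrightarrow> Re (f / (2 * pi))"
      by (intro tendsto_intros) auto
    moreover have "Re ((CLBINT t. K x (x + h n) t / h n) / (2 * pi)) = (cdf M (x + h n) - cdf M x) / h n" for n
    proof -
      have "(CLBINT t. K x (x + h n) t / h n) / (2 * pi) = (1 / (2 * pi) * (CLBINT t. K x (x + h n) t)) / h n"
        by simp
      also have "\<dots> = complex_of_real ((cdf M (x + h n) - cdf M x) / h n)"
        unfolding cdf_diff[symmetric] by simp
      finally show ?thesis by (simp only: Re_complex_of_real)
    qed
    ultimately show "((\<lambda>h. (cdf M (x + h) - cdf M x) / h) \<circ> h) \<longlonglongrightarrow> Re f / (2 * pi)"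
      by (simp add: o_def)
  qed
  then show ?thesis unfolding DERIV_def f_def .
qed

lemma norm_exp_minus_one_le:
  assumes "Re w \<ge> 0"
  shows "norm (exp (- w) - 1) \<le> norm w"
proof -
  have "norm (exp (- w) - exp 0) \<le> 1 * norm (- w - 0)"
  proof (rule field_differentiable_bound[where S = "{z. Re z \<le> 0}"])
    show "convex {z. Re z \<le> 0}" by (rule convex_halfspace_Re_le)
  qed (use assms in \<open>auto intro!: derivative_eq_intros\<close>)
  then show ?thesis by simp
qed

text \<open>The angle \<open>pi / 4\<close> is admissible for every \<open>\<alpha> < 2\<close>: for \<open>z\<close> in the sector, \<open>z powr \<alpha>\<close> has argument at most
  \<open>\<alpha> * pi / 4 < pi / 2\<close> and so keeps positive real part, while \<open>\<i> * x * z\<close> has real part at most \<open>0\<close>.\<close>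

lemma stable_integral_rotated:
  fixes x c \<alpha> :: real
  assumes "x > 0" "c > 0" "0 < \<alpha>" "\<alpha> < 2"
  shows "(LINT v:{0<..}|lborel. exp (\<i> * x * v - c * v powr \<alpha>))
       = (LINT v:{0<..}|lborel. exp (\<i> * x * v * cis (pi / 4) - c * v powr \<alpha> * cis (\<alpha> * pi / 4)) * cis (pi / 4))"
proof -
  define g where "g = (\<lambda>z::complex. exp (\<i> * x * z - c * z powr of_real \<alpha>))"
  define k where "k = c * cos (\<alpha> * (pi / 4))"
  have "\<alpha> * (pi / 4) < 2 * (pi / 4)" using assms by (intro mult_strict_right_mono) auto
  then have \<alpha>\<theta>: "\<alpha> * (pi / 4) < pi / 2" by simp
  have k: "k > 0" unfolding k_def using assms \<alpha>\<theta> by (intro mult_pos_pos cos_gt_zero_pi) (auto intro: less_trans[of _ 0])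
  have "(LINT r:{0<..}|lborel. g (complex_of_real r)) = (LINT r:{0<..}|lborel. g (rcis r (pi / 4)) * cis (pi / 4))"
  proof (rule ray_rotation[where B = "\<lambda>r. r powr 0 * exp (- k * r powr \<alpha>)"])
    show "g holomorphic_on {z. Re z > 0}"
      unfolding g_def by (intro holomorphic_intros holomorphic_powr_right_half_plane)
    show "\<bar>pi / 4\<bar> < pi / 2" by simp
    fix r t :: real assume r: "r > 0" and t: "t \<in> closed_segment 0 (pi / 4)"
    have t': "0 \<le> t" "t \<le> pi / 4"
      using t by (auto simp: closed_segment_eq_real_ivl split: if_splits)
    then have t_pi: "\<bar>t\<bar> < pi" using pi_gt_zero by linarith
    have "\<alpha> * t \<le> \<alpha> * (pi / 4)" using t' assms by (intro mult_left_mono) auto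
    then have "cos (\<alpha> * (pi / 4)) \<le> cos (\<alpha> * t)"
      using t' assms \<alpha>\<theta> pi_gt_zero by (intro cos_monotone_0_pi_le mult_nonneg_nonneg) linarith+
    then have "c * cos (\<alpha> * (pi / 4)) * r powr \<alpha> \<le> c * cos (\<alpha> * t) * r powr \<alpha>"
      using assms by (intro mult_right_mono mult_left_mono) auto
    moreover have "0 \<le> x * (r * sin t)"
      using assms r t' t_pi by (intro mult_nonneg_nonneg sin_ge_zero) auto
    moreover have "norm (g (rcis r t)) = exp (- (x * (r * sin t)) - c * (r powr \<alpha> * cos (\<alpha> * t)))"
      unfolding g_def using r t_pi by (subst rcis_powr_real) (auto simp: mult_ac)
    ultimately show "norm (g (rcis r t)) \<le> r powr 0 * exp (- k * r powr \<alpha>)"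
      using r by (simp add: k_def mult_ac)
  qed (rule times_powr_exp_limits set_integrable_powr_exp; use k assms in simp)+
  also have "(LINT r:{0<..}|lborel. g (complex_of_real r)) = (LINT v:{0<..}|lborel. exp (\<i> * x * v - c * v powr \<alpha>))"
    by (intro set_lebesgue_integral_cong) (auto simp: g_def powr_of_real)
  also have "(LINT r:{0<..}|lborel. g (rcis r (pi / 4)) * cis (pi / 4)) =
     (LINT v:{0<..}|lborel. exp (\<i> * x * v * cis (pi / 4) - c * v powr \<alpha> * cis (\<alpha> * pi / 4)) * cis (pi / 4))"
  proof (intro set_lebesgue_integral_cong allI impI)
    fix v :: real assume "v \<in> {0<..}"
    then show "g (rcis v (pi / 4)) * cis (pi / 4) =
        exp (\<i> * x * v * cis (pi / 4) - c * v powr \<alpha> * cis (\<alpha> * pi / 4)) * cis (pi / 4)"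
      unfolding g_def by (subst rcis_powr_real) (auto simp: rcis_def mult_ac)
  qed simp
  finally show ?thesis .
qed

text \<open>On the rotated ray the oscillating factor decays exponentially. After the substitution \<open>v = u / x\<close> the
  integrand is \<open>exp (\<i> * u * cis (pi / 4))\<close> times \<open>exp (- c * (u / x) powr \<alpha> * cis (\<alpha> * pi / 4))\<close>. Replacing
  the second factor by \<open>1\<close> gives the purely imaginary value \<open>\<i>\<close>, which the real part does not see; what is
  left is of order \<open>x powr (- \<alpha>)\<close>, its rescaled limit being a Gamma integral. The limit is positive
  exactly because \<open>\<alpha> < 2\<close>; for \<open>\<alpha> = 2\<close>, the Gaussian case, the sine vanishes.\<close>

lemma stable_integral_tail:
  fixes c \<alpha> :: real
  assumes c: "c > 0" and \<alpha>: "0 < \<alpha>" "\<alpha> < 2"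
  shows "((\<lambda>x. x powr (1 + \<alpha>) * Re (LINT v:{0<..}|lborel. exp (\<i> * x * v - c * v powr \<alpha>)))
           \<longlongrightarrow> c * Gamma (1 + \<alpha>) * sin (pi * \<alpha> / 2)) at_top"
proof -
  define e where "e = (\<lambda>u::real. exp (\<i> * u * cis (pi / 4)))"
  define \<omega> where "\<omega> = cis (\<alpha> * pi / 4)"
  define k where "k = sin (pi / 4)"
  \<comment> \<open>\<open>E x\<close> is \<open>x powr \<alpha>\<close> times the substituted integrand after subtraction of its value at \<open>c = 0\<close>.\<close>
  define E where "E = (\<lambda>x u::real. indicator {0<..} u *\<^sub>R (e u * (x powr \<alpha> *\<^sub>R (exp (- (c * (u / x) powr \<alpha> * \<omega>)) - 1)) * cis (pi / 4)))"
  have k: "k > 0" by (simp add: k_def sin_45)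
  have "\<alpha> * (pi / 4) < 2 * (pi / 4)" using \<alpha> by (intro mult_strict_right_mono) auto
  then have \<omega>: "Re \<omega> > 0" "norm \<omega> = 1"
    unfolding \<omega>_def using \<alpha> by (auto intro!: cos_gt_zero_pi intro: less_trans[of _ 0])
  have norm_e: "norm (e u) = exp (- (k * u))" for u by (simp add: e_def k_def)
  have [measurable]: "e \<in> borel_measurable borel" unfolding e_def by measurable
  have e_int: "set_integrable lborel {0<..} e"
    unfolding set_integrable_def
  proof (rule Bochner_Integration.integrable_bound)
    show "integrable lborel (\<lambda>u. indicator {0<..} u *\<^sub>R (u powr 0 * exp (- k * u powr 1)))"
      using set_integrable_powr_exp[of k 1 0] k unfolding set_integrable_def by simp
  qed (auto simp: norm_e indicator_def)
  have E_bound: "norm (E x u) \<le> indicator {0<..} u *\<^sub>R (c * (u powr \<alpha> * exp (- k * u powr 1)))" if "x > 0" for x u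
  proof (cases "u > 0")
    case True
    have "norm (exp (- (c * (u / x) powr \<alpha> * \<omega>)) - 1) \<le> c * (u / x) powr \<alpha>"
      using norm_exp_minus_one_le[of "c * (u / x) powr \<alpha> * \<omega>"] \<omega> c by (simp add: norm_mult)
    then have "x powr \<alpha> * norm (exp (- (c * (u / x) powr \<alpha> * \<omega>)) - 1) \<le> x powr \<alpha> * (c * (u / x) powr \<alpha>)"
      by (intro mult_left_mono) auto
    also have "\<dots> = c * u powr \<alpha>" using that True by (simp add: powr_divide)
    finally show ?thesis using True by (simp add: E_def norm_mult norm_e mult_ac)
  qed (simp add: E_def)
  have dom: "integrable lborel (\<lambda>u. indicator {0<..} u *\<^sub>R (c * (u powr \<alpha> * exp (- k * u powr 1))))"
    unfolding set_integrable_def[symmetric] using k \<alpha>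
    by (intro set_integrable_mult_right set_integrable_powr_exp) auto
  have [measurable]: "E x \<in> borel_measurable borel" for x
    unfolding E_def by measurable
  have E_int: "integrable lborel (E x)" if "x > 0" for x
    by (rule Bochner_Integration.integrable_bound[OF dom]) (use E_bound[OF that] in \<open>auto intro!: AE_I2 order_trans[OF _ abs_ge_self]\<close>)
  have main: "x powr (1 + \<alpha>) * Re (LINT v:{0<..}|lborel. exp (\<i> * x * v - c * v powr \<alpha>)) = Re (LINT u|lborel. E x u)"
    if x: "x > 0" for x
  proof -
    let ?h = "\<lambda>v. exp (\<i> * x * v * cis (pi / 4) - c * v powr \<alpha> * \<omega>) * cis (pi / 4)"
    have "(LINT v:{0<..}|lborel. exp (\<i> * x * v - c * v powr \<alpha>)) = (LINT v|lborel. indicator {0<..} v *\<^sub>R ?h v)"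
      using stable_integral_rotated[OF x c \<alpha>] by (simp only: set_lebesgue_integral_def \<omega>_def)
    also have "\<dots> = \<bar>1 / x\<bar> *\<^sub>R (LINT u|lborel. indicator {0<..} (0 + 1 / x * u) *\<^sub>R ?h (0 + 1 / x * u))"
      by (rule lborel_integral_real_affine) (use x in auto)
    also have "(\<lambda>u. indicator {0<..} (0 + 1 / x * u) *\<^sub>R ?h (0 + 1 / x * u)) =
        (\<lambda>u. indicator {0<..} u *\<^sub>R (e u * cis (pi / 4)) + x powr (- \<alpha>) *\<^sub>R E x u)"
    proof
      fix u
      show "indicator {0<..} (0 + 1 / x * u) *\<^sub>R ?h (0 + 1 / x * u) =
        indicator {0<..} u *\<^sub>R (e u * cis (pi / 4)) + x powr (- \<alpha>) *\<^sub>R E x u"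
      proof (cases "u > 0")
        case True
        have "?h (u / x) = e u * exp (- (c * (u / x) powr \<alpha> * \<omega>)) * cis (pi / 4)"
          unfolding e_def exp_add[symmetric] using x by simp
        moreover have "x powr (- \<alpha>) * x powr \<alpha> = 1" using x by (simp add: powr_minus)
        ultimately show ?thesis using True x
          by (simp add: E_def scaleR_conv_of_real algebra_simps flip: of_real_mult) (simp flip: of_real_mult mult.assoc)
      qed (use x in \<open>auto simp: E_def field_simps\<close>)
    qed
    also have "(LINT u|lborel. indicator {0<..} u *\<^sub>R (e u * cis (pi / 4)) + x powr (- \<alpha>) *\<^sub>R E x u) =
        (LINT u:{0<..}|lborel. e u * cis (pi / 4)) + x powr (- \<alpha>) *\<^sub>R (LINT u|lborel. E x u)"
      unfolding set_lebesgue_integral_def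
      using set_integrable_mult_left[of "cis (pi / 4)" lborel "{0<..}" e] e_int E_int[OF x]
      by (subst Bochner_Integration.integral_add) (auto simp: set_integrable_def)
    also have "(LINT u:{0<..}|lborel. e u * cis (pi / 4)) = \<i>"
    proof -
      have "(LINT u:{0<..}|lborel. e u) = (LINT u:{0<..}|lborel. u powr 0 *\<^sub>R exp (\<i> * u * cis (pi / 4)))"
        by (intro set_lebesgue_integral_cong) (auto simp: e_def)
      also have "\<dots> = cis (pi / 4)" using Gamma_rotated_ray[of 0] by simp
      finally show ?thesis by (simp add: cis_mult)
    qed
    finally have "Re (LINT v:{0<..}|lborel. exp (\<i> * x * v - c * v powr \<alpha>)) = x powr (- \<alpha>) / x * Re (LINT u|lborel. E x u)"
      using x by simp
    then have "x powr (1 + \<alpha>) * Re (LINT v:{0<..}|lborel. exp (\<i> * x * v - c * v powr \<alpha>)) =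
        (x powr (1 + \<alpha>) * (x powr (- \<alpha>) / x)) * Re (LINT u|lborel. E x u)" by (simp only: mult.assoc)
    also have "x powr (1 + \<alpha>) * (x powr (- \<alpha>) / x) = 1" using x by (simp add: powr_add powr_minus)
    finally show ?thesis by simp
  qed
  have "((\<lambda>x. LINT u|lborel. E x u) \<longlongrightarrow> (LINT u|lborel. indicator {0<..} u *\<^sub>R (e u * (- (c * u powr \<alpha> * \<omega>)) * cis (pi / 4)))) at_top"
  proof (rule integral_dominated_convergence_at_top[OF _ _ dom])
    show "\<forall>\<^sub>F x in at_top. AE u in lborel. norm (E x u) \<le> indicator {0<..} u *\<^sub>R (c * (u powr \<alpha> * exp (- k * u powr 1)))"
      using eventually_gt_at_top[of 0] by eventually_elim (use E_bound in auto)
    show "AE u in lborel. ((\<lambda>x. E x u) \<longlongrightarrow> indicator {0<..} u *\<^sub>R (e u * (- (c * u powr \<alpha> * \<omega>)) * cis (pi / 4))) at_top"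
    proof (rule AE_I2)
      fix u :: real
      have "((\<lambda>x. x powr \<alpha> *\<^sub>R (exp (- (c * (u / x) powr \<alpha> * \<omega>)) - 1)) \<longlongrightarrow> - (c * u powr \<alpha> * \<omega>)) at_top" if u: "u > 0"
      proof -
        define h where "h = (\<lambda>x. - (complex_of_real (c * u powr \<alpha> * x powr (-\<alpha>)) * \<omega>))"
        have "((\<lambda>w::complex. (exp w - 1) / w) \<longlongrightarrow> 1) (at 0)"
          using DERIV_exp[of "0::complex"] by (simp add: DERIV_def)
        moreover have "filterlim h (at 0) at_top"
          unfolding filterlim_at
        proof
          have "((\<lambda>x::real. x powr (-\<alpha>)) \<longlongrightarrow> 0) at_top" using \<alpha> by real_asymp
          then have "(h \<longlongrightarrow> - (complex_of_real (c * u powr \<alpha> * 0) * \<omega>)) at_top"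
            unfolding h_def by (intro tendsto_intros)
          then show "(h \<longlongrightarrow> 0) at_top" by simp
          show "\<forall>\<^sub>F x in at_top. h x \<in> UNIV \<and> h x \<noteq> 0"
            using eventually_gt_at_top[of 0] by eventually_elim (use c u \<omega> in \<open>auto simp: h_def\<close>)
        qed
        ultimately have "((\<lambda>x. (exp (h x) - 1) / h x) \<longlongrightarrow> 1) at_top"
          by (rule filterlim_compose)
        from tendsto_mult_left[OF this, of "- (c * u powr \<alpha> * \<omega>)"]
        have "((\<lambda>x. - (c * u powr \<alpha> * \<omega>) * ((exp (h x) - 1) / h x)) \<longlongrightarrow> - (c * u powr \<alpha> * \<omega>)) at_top"
          by simp
        moreover have "\<forall>\<^sub>F x in at_top. - (c * u powr \<alpha> * \<omega>) * ((exp (h x) - 1) / h x) =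
            x powr \<alpha> *\<^sub>R (exp (- (c * (u / x) powr \<alpha> * \<omega>)) - 1)"
          using eventually_gt_at_top[of 0]
        proof eventually_elim
          case (elim x)
          have h: "h x = - (c * (u / x) powr \<alpha> * \<omega>)"
            using elim u by (simp add: h_def powr_divide powr_minus field_simps)
          have "- (c * u powr \<alpha> * \<omega>) = x powr \<alpha> * h x"
            using elim u by (simp add: h powr_divide)
          moreover have "h x \<noteq> 0" using c u \<omega> elim by (auto simp: h)
          ultimately have "- (c * u powr \<alpha> * \<omega>) * ((exp (h x) - 1) / h x) = x powr \<alpha> *\<^sub>R (exp (h x) - 1)"
            by (simp add: scaleR_conv_of_real)
          then show ?case by (simp only: h)
        qed
        ultimately show ?thesis by (rule Lim_transform_eventually)
      qed
      note lim = this
      show "((\<lambda>x. E x u) \<longlongrightarrow> indicator {0<..} u *\<^sub>R (e u * (- (c * u powr \<alpha> * \<omega>)) * cis (pi / 4))) at_top"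
      proof (cases "u > 0")
        case True
        show ?thesis unfolding E_def
          by (intro tendsto_scaleR tendsto_mult tendsto_const lim True)
      qed (simp add: E_def)
    qed
  qed auto
  moreover have "Re (LINT u|lborel. indicator {0<..} u *\<^sub>R (e u * (- (c * u powr \<alpha> * \<omega>)) * cis (pi / 4))) =
      c * Gamma (1 + \<alpha>) * sin (pi * \<alpha> / 2)"
  proof -
    have "(LINT u|lborel. indicator {0<..} u *\<^sub>R (e u * (- (c * u powr \<alpha> * \<omega>)) * cis (pi / 4))) =
       (LINT u:{0<..}|lborel. (- (c * \<omega> * cis (pi / 4))) * (u powr \<alpha> *\<^sub>R exp (\<i> * u * cis (pi / 4))))"
      unfolding set_lebesgue_integral_def e_def
      by (intro Bochner_Integration.integral_cong) (auto simp: scaleR_conv_of_real)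
    also have "\<dots> = - (c * \<omega> * cis (pi / 4)) * (Gamma (1 + \<alpha>) * cis (pi * (1 + \<alpha>) / 4))"
      by (subst set_integral_mult_right) (subst Gamma_rotated_ray, use \<alpha> in auto)
    also have "\<dots> = - of_real (c * Gamma (1 + \<alpha>)) * (cis (\<alpha> * pi / 4) * cis (pi / 4) * cis (pi * (1 + \<alpha>) / 4))"
      by (simp add: \<omega>_def)
    also have "cis (\<alpha> * pi / 4) * cis (pi / 4) * cis (pi * (1 + \<alpha>) / 4) = cis (pi * \<alpha> / 2 + pi / 2)"
      unfolding cis_mult by (rule arg_cong[where f = cis]) (simp add: field_simps)
    finally show ?thesis by (simp add: cos_add)
  qed
  ultimately have "((\<lambda>x. Re (LINT u|lborel. E x u)) \<longlongrightarrow> c * Gamma (1 + \<alpha>) * sin (pi * \<alpha> / 2)) at_top"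
    using tendsto_Re by fastforce
  then show ?thesis
  proof (rule Lim_transform_eventually)
    show "\<forall>\<^sub>F x in at_top. Re (LINT u|lborel. E x u) =
        x powr (1 + \<alpha>) * Re (LINT v:{0<..}|lborel. exp (\<i> * x * v - c * v powr \<alpha>))"
      using eventually_gt_at_top[of 0] by eventually_elim (rule main[symmetric])
  qed
qed

text \<open>The characteristic function is real and even, so the inversion integral is twice the real part of the
  half-line integral treated above.\<close>

lemma stable_density:
  fixes c \<alpha> :: real
  assumes "real_distribution \<mu>" and c: "c > 0" and \<alpha>: "0 < \<alpha>" "\<alpha> < 2"
    and char: "\<And>z. char \<mu> z = complex_of_real (exp (- c * \<bar>z\<bar> powr \<alpha>))"
  obtains f \<kappa> where "\<And>x. (cdf \<mu> has_real_derivative f x) (at x)" "f \<in> borel_measurable borel"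
    "\<And>x. 0 \<le> f x" "\<kappa> > 0" "((\<lambda>x. x powr (1 + \<alpha>) * f x) \<longlongrightarrow> \<kappa>) at_top"
proof -
  interpret real_distribution \<mu> by fact
  define f where "f = (\<lambda>x. Re (CLBINT t. iexp (- (t * x)) * char \<mu> t) / (2 * pi))"
  have half: "set_integrable lborel {0<..} (\<lambda>r. exp (- c * r powr \<alpha>))"
  proof -
    have "set_integrable lborel {0<..} (\<lambda>r. r powr 0 * exp (- c * r powr \<alpha>))"
      using c \<alpha> by (intro set_integrable_powr_exp) auto
    also have "?this \<longleftrightarrow> ?thesis" by (intro set_integrable_cong) auto
    finally show ?thesis .
  qed
  have char_int: "integrable lborel (char \<mu>)"
  proof -
    have i1: "integrable lborel (\<lambda>t. indicator {0<..} t * exp (- c * \<bar>t\<bar> powr \<alpha>))"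
      using half unfolding set_integrable_def
      by (rule Bochner_Integration.integrable_cong[THEN iffD1, rotated -1]) (auto simp: indicator_def)
    have i2: "integrable lborel (\<lambda>t. indicator {0<..} (-t) * exp (- c * \<bar>-t\<bar> powr \<alpha>))"
      using lborel_integrable_real_affine[OF i1, of "-1" 0] by simp
    have "integrable lborel (\<lambda>t. exp (- c * \<bar>t\<bar> powr \<alpha>))"
    proof (rule integrable_cong_AE_imp[OF Bochner_Integration.integrable_add[OF i1 i2]])
      show "AE t in lborel. indicator {0<..} t * exp (- c * \<bar>t\<bar> powr \<alpha>) +
            indicator {0<..} (- t) * exp (- c * \<bar>- t\<bar> powr \<alpha>) = exp (- c * \<bar>t\<bar> powr \<alpha>)"
        using AE_lborel_singleton[of 0] by eventually_elim (auto simp: indicator_def)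
    qed measurable
    then have "integrable lborel (\<lambda>t. complex_of_real (exp (- c * \<bar>t\<bar> powr \<alpha>)))" by simp
    then show ?thesis by (simp add: char[abs_def])
  qed
  have deriv: "(cdf \<mu> has_real_derivative f x) (at x)" for x
    unfolding f_def by (rule cdf_has_density_of_integrable_char[OF char_int])
  have nonneg: "0 \<le> f x" for x
  proof -
    have "((\<lambda>h. (cdf \<mu> (x + h) - cdf \<mu> x) / h) \<longlongrightarrow> f x) (at_right 0)"
      using deriv[of x] unfolding DERIV_def by (rule tendsto_mono[rotated]) (rule at_le, simp)
    then show ?thesis
      by (rule tendsto_lowerbound)
         (use eventually_at_right_less[of "0::real"] in
           \<open>auto elim!: eventually_mono intro!: divide_nonneg_pos simp: cdf_nondecreasing\<close>)
  qed
  have meas: "f \<in> borel_measurable borel"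
  proof -
    have "(\<lambda>x. CLBINT t. iexp (- (t * x)) * char \<mu> t) \<in> borel_measurable borel"
      by (intro lborel.borel_measurable_lebesgue_integral) measurable
    then show ?thesis unfolding f_def by measurable
  qed
  have eq: "f x = Re (LINT v:{0<..}|lborel. exp (\<i> * x * v - c * v powr \<alpha>)) / pi" for x
  proof -
    define h where "h = (\<lambda>t. cos (t * x) * exp (- c * \<bar>t\<bar> powr \<alpha>))"
    have int: "integrable lborel (\<lambda>t. iexp (- (t * x)) * char \<mu> t)"
      by (rule Bochner_Integration.integrable_bound[OF integrable_norm[OF char_int]]) (auto simp: norm_mult)
    have Re_eq: "Re (iexp (- (t * x)) * char \<mu> t) = h t" for t
      by (simp add: h_def char Re_exp)
    have h_int: "integrable lborel h" using integrable_Re[OF int] by (simp only: Re_eq)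
    have h_even: "h (- t) = h t" for t by (simp add: h_def)
    have h1: "integrable lborel (\<lambda>t. indicator {0<..} t * h t)"
      using h_int integrable_mult_indicator[of "{0<..}" lborel h] by simp
    have h2: "integrable lborel (\<lambda>t. indicator {0<..} (-t) * h (-t))"
      using lborel_integrable_real_affine[OF h1, of "-1" 0] by simp
    have "Re (CLBINT t. iexp (- (t * x)) * char \<mu> t) = (LBINT t. h t)"
      using integral_Re[OF int] by (simp only: Re_eq)
    also have "\<dots> = (LBINT t. indicator {0<..} t * h t + indicator {0<..} (- t) * h (- t))"
    proof (rule integral_cong_AE)
      show "AE t in lborel. h t = indicator {0<..} t * h t + indicator {0<..} (- t) * h (- t)"
        using AE_lborel_singleton[of 0] by eventually_elim (auto simp: indicator_def h_even)
    qed (use h_int h1 h2 in auto)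
    also have "\<dots> = (LBINT t. indicator {0<..} t * h t) + (LBINT t. indicator {0<..} (- t) * h (- t))"
      using h1 h2 by (rule Bochner_Integration.integral_add)
    also have "(LBINT t. indicator {0<..} (- t) * h (- t)) = (LBINT t. indicator {0<..} t * h t)"
      using lborel_integral_real_affine[of "-1" "\<lambda>t. indicator {0<..} t * h t" 0] by simp
    also have "(LBINT t. indicator {0<..} t * h t) = Re (LINT v:{0<..}|lborel. exp (\<i> * x * v - c * v powr \<alpha>))"
    proof -
      have "integrable lborel (\<lambda>v. indicator {0<..} v *\<^sub>R exp (\<i> * x * v - c * v powr \<alpha>))"
        by (rule Bochner_Integration.integrable_bound[OF half[unfolded set_integrable_def]]) (auto simp: indicator_def)
      then show ?thesis
        unfolding set_lebesgue_integral_def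
        by (subst integral_Re[symmetric]) (auto intro!: Bochner_Integration.integral_cong simp: indicator_def h_def Re_exp mult_ac)
    qed
    finally show ?thesis by (simp add: f_def)
  qed
  have "((\<lambda>x. x powr (1 + \<alpha>) * f x) \<longlongrightarrow> c * Gamma (1 + \<alpha>) * sin (pi * \<alpha> / 2) / pi) at_top"
    using tendsto_divide[OF stable_integral_tail[OF c \<alpha>] tendsto_const[of pi]] by (simp add: eq)
  moreover have "c * Gamma (1 + \<alpha>) * sin (pi * \<alpha> / 2) / pi > 0"
    using c \<alpha> by (intro divide_pos_pos mult_pos_pos sin_gt_zero) (auto intro: Gamma_real_pos)
  ultimately show ?thesis using that[of f] deriv meas nonneg by blast
qed

section \<open>Total variation between maxima of independent variables\<close>

lemma (in real_distribution) eq_density_of_cdf_deriv: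
  assumes deriv: "\<And>x. (cdf M has_real_derivative f x) (at x)"
    and [measurable]: "f \<in> borel_measurable borel" and nonneg: "\<And>x. 0 \<le> f x"
  shows "M = density lborel f"
proof (rule measure_eqI_generator_eq[where \<Omega>=UNIV and E = "range (\<lambda>(a, b). {a<..b::real})"
      and A = "\<lambda>i. {- real i<..real i}"])
  fix X assume "X \<in> range (\<lambda>(a, b). {a<..b::real})"
  then obtain a b where X: "X = {a<..b}" by auto
  show "emeasure M X = emeasure (density lborel f) X"
  proof (cases "a \<le> b")
    case True
    have "emeasure (density lborel f) X = (\<integral>\<^sup>+x. ennreal (f x) * indicator {a<..b} x \<partial>lborel)"
      by (simp add: X emeasure_density)
    also have "\<dots> = (\<integral>\<^sup>+x. ennreal (f x) * indicator {a..b} x \<partial>lborel)"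
      by (intro nn_integral_cong_AE AE_I[of _ _ "{a}"]) (auto split: split_indicator)
    also have "\<dots> = ennreal (cdf M b - cdf M a)"
      using True nonneg DERIV_subset[OF deriv] by (intro nn_integral_FTC_Icc) (auto simp: has_real_derivative_iff_has_vector_derivative[symmetric])
    finally show ?thesis using True by (simp add: X emeasure_Ioc)
  qed (simp add: X)
next
  show "(\<Union>i. {- real (i::nat)<..real i}) = UNIV"
    by (rule UN_Ioc_eq_UNIV)
qed (auto simp: emeasure_Ioc borel_sigma_sets_Ioc Int_stable_def)

text \<open>A nonnegative derivative of a function with values in \<open>[0, 1]\<close> has total mass at most \<open>1\<close>. This is used
  for the density of the second largest of \<open>n\<close> variables without first constructing its law.\<close>

lemma nn_integral_deriv_le:
  fixes f F :: "real \<Rightarrow> real"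
  assumes deriv: "\<And>x. (F has_real_derivative f x) (at x)"
    and [measurable]: "f \<in> borel_measurable borel" and nonneg: "\<And>x. 0 \<le> f x"
    and F: "\<And>x. 0 \<le> F x" "\<And>x. F x \<le> 1"
  shows "(\<integral>\<^sup>+x. ennreal (f x) \<partial>lborel) \<le> 1"
proof -
  have "(\<integral>\<^sup>+x. ennreal (f x) * indicator {- real n..real n} x \<partial>lborel) \<le> 1" for n :: nat
  proof -
    have "(\<integral>\<^sup>+x. ennreal (f x) * indicator {- real n..real n} x \<partial>lborel) = ennreal (F (real n) - F (- real n))"
      using nonneg DERIV_subset[OF deriv] by (intro nn_integral_FTC_Icc) (auto simp: has_real_derivative_iff_has_vector_derivative[symmetric])
    also have "\<dots> \<le> 1" using F[of "real n"] F[of "- real n"] by simp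
    finally show ?thesis .
  qed
  moreover have "(\<lambda>n::nat. \<integral>\<^sup>+x. ennreal (f x) * indicator {- real n..real n} x \<partial>lborel)
      \<longlonglongrightarrow> (\<integral>\<^sup>+x. ennreal (f x) \<partial>lborel)"
  proof (rule nn_integral_LIMSEQ)
    show "incseq (\<lambda>n x. ennreal (f x) * indicator {- real n..real n} x)"
      by (auto simp: incseq_def le_fun_def split: split_indicator)
    fix x :: real
    obtain m :: nat where "\<bar>x\<bar> < m" using reals_Archimedean2 by blast
    then show "(\<lambda>n. ennreal (f x) * indicator {- real n..real n} x) \<longlonglongrightarrow> ennreal (f x)"
      by (intro tendsto_eventually eventually_sequentiallyI[of m]) (auto simp: indicator_def)
  qed auto
  ultimately show ?thesis
    by (intro LIMSEQ_le_const2) auto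
qed

lemma power_diff_bounds:
  fixes a b :: real
  assumes "0 \<le> b" "b \<le> a"
  shows "k * b ^ (k - 1) * (a - b) \<le> a ^ k - b ^ k" "a ^ k - b ^ k \<le> k * a ^ (k - 1) * (a - b)"
proof -
  have eq: "a ^ k - b ^ k = (a - b) * (\<Sum>i<k. b ^ (k - Suc i) * a ^ i)"
    by (rule power_diff_sumr2)
  have pw: "y ^ (k - 1) = y ^ (k - Suc i) * y ^ i" if "i < k" for i and y :: real
    using that by (simp flip: power_add)
  have "(\<Sum>i<k. b ^ (k - 1)) \<le> (\<Sum>i<k. b ^ (k - Suc i) * a ^ i)"
    using assms by (intro sum_mono) (auto simp only: pw lessThan_iff intro!: mult_left_mono power_mono zero_le_power)
  then have "(a - b) * (k * b ^ (k - 1)) \<le> (a - b) * (\<Sum>i<k. b ^ (k - Suc i) * a ^ i)"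
    using assms by (intro mult_left_mono) auto
  then show "k * b ^ (k - 1) * (a - b) \<le> a ^ k - b ^ k" by (simp add: eq mult_ac)
  have "(\<Sum>i<k. b ^ (k - Suc i) * a ^ i) \<le> (\<Sum>i<k. a ^ (k - 1))"
    using assms by (intro sum_mono) (auto simp only: pw lessThan_iff intro!: mult_right_mono power_mono zero_le_power)
  then have "(a - b) * (\<Sum>i<k. b ^ (k - Suc i) * a ^ i) \<le> (a - b) * (k * a ^ (k - 1))"
    using assms by (intro mult_left_mono) auto
  then show "a ^ k - b ^ k \<le> k * a ^ (k - 1) * (a - b)" by (simp add: eq mult_ac)
qed

text \<open>Pointwise comparison of the densities of two maxima of \<open>n = Suc m\<close> variables. Here \<open>a, b\<close> stand for the
  values of the two distribution functions and \<open>u, v\<close> for those of the densities. The last error term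
  is the density of the second largest variable: replacing \<open>a ^ m\<close> by \<open>b ^ m\<close> costs
  \<open>m * a ^ (m - 1) * (a - b)\<close>, and the factor \<open>a - b\<close> is a fraction of the tail \<open>1 - a\<close>.\<close>

lemma max_density_comparison:
  fixes a b u v \<epsilon> :: real
  assumes a: "0 \<le> a" "a \<le> 1" and b: "0 \<le> b" and u: "0 \<le> u" and \<epsilon>: "0 \<le> \<epsilon>" "\<epsilon> \<le> 1"
    and ab: "a - b \<le> \<epsilon> * (1 - a)" and uv: "(1 - \<epsilon>) * u \<le> v"
  shows "real (Suc m) * a ^ m * u \<le> real (Suc m) * b ^ m * v
          + \<epsilon> * (real (Suc m) * a ^ m * u) + \<epsilon> * (real (Suc m) * (m * a ^ (m - 1) * (1 - a)) * u)"
proof -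
  have "(1 - \<epsilon>) * (a ^ m - b ^ m) \<le> \<epsilon> * (m * a ^ (m - 1) * (1 - a))"
  proof (cases "b \<le> a")
    case True
    have "(1 - \<epsilon>) * (a ^ m - b ^ m) \<le> 1 * (a ^ m - b ^ m)"
      using True b \<epsilon> by (intro mult_right_mono) (auto intro: power_mono)
    also have "\<dots> \<le> m * a ^ (m - 1) * (a - b)"
      using power_diff_bounds(2)[OF b True, of m] by simp
    also have "\<dots> \<le> m * a ^ (m - 1) * (\<epsilon> * (1 - a))"
      using ab a by (intro mult_left_mono) auto
    finally show ?thesis by (simp add: mult_ac)
  next
    case False
    then have "a ^ m \<le> b ^ m" using a by (intro power_mono) auto
    then have "(1 - \<epsilon>) * (a ^ m - b ^ m) \<le> 0" using \<epsilon> by (simp add: mult_nonneg_nonpos)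
    also have "\<dots> \<le> \<epsilon> * (m * a ^ (m - 1) * (1 - a))" using a \<epsilon> by simp
    finally show ?thesis .
  qed
  then have "Suc m * u * ((1 - \<epsilon>) * (a ^ m - b ^ m)) \<le> Suc m * u * (\<epsilon> * (m * a ^ (m - 1) * (1 - a)))"
    using u by (intro mult_left_mono) auto
  moreover have "Suc m * b ^ m * ((1 - \<epsilon>) * u) \<le> Suc m * b ^ m * v"
    using uv b by (intro mult_left_mono) auto
  ultimately show ?thesis by (simp add: algebra_simps)
qed

text \<open>If two densities agree beyond \<open>K\<close> up to the relative error \<open>\<epsilon>\<close>, then the maxima of \<open>n\<close> variables have
  laws at distance at most \<open>2 * \<epsilon>\<close> plus the probability that a maximum stays below \<open>K\<close>. The point is that
  the constant \<open>2\<close> does not grow with \<open>n\<close>: the error from the density and the error from the distribution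
  function are \<open>\<epsilon>\<close> times the densities of the largest and of the second largest variable, both of mass at
  most \<open>1\<close>. An upper bound for \<open>M1 A - M2 A\<close> suffices, since passing to the complement reverses the sign.\<close>

lemma max_law_close:
  fixes \<mu> \<nu> M1 M2 :: "real measure" and f g :: "real \<Rightarrow> real"
  assumes \<mu>: "real_distribution \<mu>" and \<nu>: "real_distribution \<nu>"
    and M1: "real_distribution M1" and M2: "real_distribution M2"
    and n: "n \<ge> 1"
    and cdf1: "\<And>x. cdf M1 x = cdf \<mu> x ^ n" and cdf2: "\<And>x. cdf M2 x = cdf \<nu> x ^ n"
    and f: "\<And>x. (cdf \<mu> has_real_derivative f x) (at x)" and g: "\<And>x. (cdf \<nu> has_real_derivative g x) (at x)"
    and [measurable]: "f \<in> borel_measurable borel" "g \<in> borel_measurable borel"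
    and f0: "\<And>x. 0 \<le> f x" and g0: "\<And>x. 0 \<le> g x"
    and \<epsilon>: "0 \<le> \<epsilon>" "\<epsilon> \<le> 1"
    and fg: "\<And>x. x > K \<Longrightarrow> \<bar>g x - f x\<bar> \<le> \<epsilon> * f x"
    and A: "A \<in> sets borel"
  shows "\<bar>measure M1 A - measure M2 A\<bar> \<le> cdf \<mu> K ^ n + 2 * \<epsilon>"
proof -
  interpret \<mu>: real_distribution \<mu> by fact
  interpret \<nu>: real_distribution \<nu> by fact
  interpret M1: real_distribution M1 by fact
  interpret M2: real_distribution M2 by fact
  let ?F = "cdf \<mu>" and ?G = "cdf \<nu>"
  obtain m where m: "n = Suc m" using n by (cases n) auto
  define h1 h2 q where "h1 = (\<lambda>x. real (Suc m) * ?F x ^ m * f x)"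
    and "h2 = (\<lambda>x. real (Suc m) * ?G x ^ m * g x)"
    and "q = (\<lambda>x. real (Suc m) * (m * ?F x ^ (m - 1) * (1 - ?F x)) * f x)"
  have F: "0 \<le> ?F x" "?F x \<le> 1" for x by (simp_all add: \<mu>.cdf_nonneg \<mu>.cdf_bounded_prob)
  have G: "0 \<le> ?G x" "?G x \<le> 1" for x by (simp_all add: \<nu>.cdf_nonneg \<nu>.cdf_bounded_prob)
  have [measurable]: "?F \<in> borel_measurable borel" "?G \<in> borel_measurable borel"
    by (auto intro!: borel_measurable_mono simp: mono_def \<mu>.cdf_nondecreasing \<nu>.cdf_nondecreasing)
  have [measurable]: "h1 \<in> borel_measurable borel" "h2 \<in> borel_measurable borel" "q \<in> borel_measurable borel"
    unfolding h1_def h2_def q_def by measurable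
  have nonneg: "0 \<le> h1 x" "0 \<le> h2 x" "0 \<le> q x" for x
    using F[of x] G[of x] f0[of x] g0[of x] by (auto simp: h1_def h2_def q_def)
  have "((\<lambda>x. ?F x ^ n) has_real_derivative h1 x) (at x)" for x
    unfolding m h1_def by (rule derivative_eq_intros f refl)+ (simp add: mult_ac)
  then have M1_eq: "M1 = density lborel h1"
    using nonneg by (intro M1.eq_density_of_cdf_deriv) (simp_all add: cdf1[abs_def])
  have "((\<lambda>x. ?G x ^ n) has_real_derivative h2 x) (at x)" for x
    unfolding m h2_def by (rule derivative_eq_intros g refl)+ (simp add: mult_ac)
  then have M2_eq: "M2 = density lborel h2"
    using nonneg by (intro M2.eq_density_of_cdf_deriv) (simp_all add: cdf2[abs_def])
  \<comment> \<open>The second largest variable has distribution function \<open>n F ^ (n - 1) - (n - 1) F ^ n\<close>.\<close>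
  have q1: "(\<integral>\<^sup>+x. ennreal (q x) \<partial>lborel) \<le> 1"
  proof (rule nn_integral_deriv_le[where F = "\<lambda>x. real (Suc m) * ?F x ^ m - real m * ?F x ^ Suc m"])
    fix x
    show "((\<lambda>x. real (Suc m) * ?F x ^ m - real m * ?F x ^ Suc m) has_real_derivative q x) (at x)"
      unfolding q_def by (rule derivative_eq_intros f refl)+ (cases m, simp_all add: algebra_simps)
    have "?F x ^ m * (real m * ?F x) \<le> ?F x ^ m * real (Suc m)"
      using F[of x] mult_left_le[of "?F x" "real m"] by (intro mult_left_mono) auto
    then show "0 \<le> real (Suc m) * ?F x ^ m - real m * ?F x ^ Suc m"
      by (simp add: mult_ac)
    show "real (Suc m) * ?F x ^ m - real m * ?F x ^ Suc m \<le> 1"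
      using power_diff_bounds(1)[of "?F x" 1 "Suc m"] F[of x] by (simp add: algebra_simps)
  qed (auto intro: nonneg)
  \<comment> \<open>Integrating the relative error over \<open>(x, \<infinity>)\<close>: \<open>(1 + \<epsilon>) F - G\<close> increases beyond \<open>K\<close> to its limit \<open>\<epsilon>\<close>.\<close>
  have cdf_close: "?F x - ?G x \<le> \<epsilon> * (1 - ?F x)" if "x \<ge> K" for x
  proof -
    have "(1 + \<epsilon>) * ?F x - ?G x \<le> \<epsilon>"
    proof (rule tendsto_lowerbound)
      have "((\<lambda>y. (1 + \<epsilon>) * ?F y - ?G y) \<longlongrightarrow> (1 + \<epsilon>) * 1 - 1) at_top"
        by (intro tendsto_intros \<mu>.cdf_lim_at_top_prob \<nu>.cdf_lim_at_top_prob)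
      then show "((\<lambda>y. (1 + \<epsilon>) * ?F y - ?G y) \<longlongrightarrow> \<epsilon>) at_top" by simp
      show "\<forall>\<^sub>F y in at_top. (1 + \<epsilon>) * ?F x - ?G x \<le> (1 + \<epsilon>) * ?F y - ?G y"
        using eventually_ge_at_top[of x]
      proof eventually_elim
        case (elim y)
        show ?case
        proof (rule DERIV_nonneg_imp_increasing_open[OF elim])
          fix z assume z: "x < z" "z < y"
          have "((\<lambda>y. (1 + \<epsilon>) * ?F y - ?G y) has_real_derivative (1 + \<epsilon>) * f z - g z) (at z)"
            by (auto intro!: derivative_eq_intros f g)
          moreover have "(1 + \<epsilon>) * f z - g z \<ge> 0"
            using fg[of z] z that by (auto simp: algebra_simps abs_le_iff)
          ultimately show "\<exists>d. ((\<lambda>y. (1 + \<epsilon>) * ?F y - ?G y) has_real_derivative d) (at z) \<and> 0 \<le> d" by blast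
        next
          show "continuous_on {x..y} (\<lambda>y. (1 + \<epsilon>) * ?F y - ?G y)"
            by (intro continuous_intros continuous_at_imp_continuous_on ballI DERIV_isCont[OF f] DERIV_isCont[OF g])
        qed
      qed
    qed simp
    then show ?thesis by (simp add: algebra_simps)
  qed
  have dens: "h1 x \<le> h2 x + \<epsilon> * h1 x + \<epsilon> * q x" if x: "x > K" for x
    unfolding h1_def h2_def q_def
    by (rule max_density_comparison) 
       (use F[of x] G[of x] f0[of x] \<epsilon> cdf_close[of x] fg[OF x] x in \<open>auto simp: algebra_simps abs_le_iff\<close>)
  have one_sided: "measure M1 A \<le> measure M2 A + (?F K ^ n + 2 * \<epsilon>)" if A: "A \<in> sets borel" for A
  proof -
    note [measurable] = A
    have "emeasure M1 (A \<inter> {K<..}) = (\<integral>\<^sup>+x. ennreal (h1 x) * indicator (A \<inter> {K<..}) x \<partial>lborel)"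
      unfolding M1_eq by (simp add: emeasure_density)
    also have "\<dots> \<le> (\<integral>\<^sup>+x. ennreal (h2 x) * indicator A x + ennreal \<epsilon> * ennreal (h1 x) + ennreal \<epsilon> * ennreal (q x) \<partial>lborel)"
    proof (rule nn_integral_mono)
      fix x
      show "ennreal (h1 x) * indicator (A \<inter> {K<..}) x
        \<le> ennreal (h2 x) * indicator A x + ennreal \<epsilon> * ennreal (h1 x) + ennreal \<epsilon> * ennreal (q x)"
        using dens[of x] nonneg[of x] \<epsilon>
        by (auto split: split_indicator simp flip: ennreal_mult ennreal_plus intro!: ennreal_leI)
    qed
    also have "\<dots> = emeasure M2 A + ennreal \<epsilon> * (\<integral>\<^sup>+x. ennreal (h1 x) \<partial>lborel) + ennreal \<epsilon> * (\<integral>\<^sup>+x. ennreal (q x) \<partial>lborel)"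
      unfolding M2_eq by (simp add: emeasure_density nn_integral_add nn_integral_cmult)
    also have "(\<integral>\<^sup>+x. ennreal (h1 x) \<partial>lborel) = 1"
      using M1.emeasure_space_1 unfolding M1_eq by (simp add: emeasure_density)
    also have "emeasure M2 A + ennreal \<epsilon> * 1 + ennreal \<epsilon> * (\<integral>\<^sup>+x. ennreal (q x) \<partial>lborel) \<le>
       emeasure M2 A + ennreal \<epsilon> * 1 + ennreal \<epsilon> * 1"
      by (intro add_mono mult_left_mono q1) auto
    also have "\<dots> = ennreal (measure M2 A + \<epsilon> + \<epsilon>)"
      using \<epsilon> by (simp add: M2.emeasure_eq_measure flip: ennreal_plus)
    finally have "ennreal (measure M1 (A \<inter> {K<..})) \<le> ennreal (measure M2 A + \<epsilon> + \<epsilon>)"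
      unfolding M1.emeasure_eq_measure .
    then have tail: "measure M1 (A \<inter> {K<..}) \<le> measure M2 A + \<epsilon> + \<epsilon>"
      by (subst (asm) ennreal_le_iff) (use \<epsilon> in auto)
    have "measure M1 A \<le> measure M1 ((A \<inter> {K<..}) \<union> {..K})"
      by (intro M1.finite_measure_mono) auto
    also have "\<dots> \<le> measure M1 (A \<inter> {K<..}) + measure M1 {..K}"
      by (intro measure_Un_le) auto
    also have "measure M1 {..K} = ?F K ^ n" using cdf1[of K] by (simp add: cdf_def2)
    finally show ?thesis using tail by simp
  qed
  have "measure M1 (UNIV - A) = 1 - measure M1 A" "measure M2 (UNIV - A) = 1 - measure M2 A"
    using A M1.prob_compl[of A] M2.prob_compl[of A] by auto
  with one_sided[OF A] one_sided[of "UNIV - A"] A show ?thesis by (auto simp: abs_le_iff)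
qed

text \<open>A density with an exact power tail is asymptotically unchanged, in the sense of relative error, by an
  affine change of variable close to the identity. The filter \<open>Fl\<close> makes the limit uniform: it lets
  \<open>m \<rightarrow> 0\<close>, \<open>r \<rightarrow> 1\<close> and \<open>x \<rightarrow> \<infinity>\<close> independently. A Gaussian density lacks this property.\<close>

lemma tail_density_affine_stable:
  fixes f :: "real \<Rightarrow> real"
  assumes tail: "((\<lambda>x. x powr p * f x) \<longlongrightarrow> \<kappa>) at_top" and \<kappa>: "\<kappa> > 0" and \<epsilon>: "\<epsilon> > 0"
  shows "\<exists>\<delta>>0. \<exists>K. \<forall>m r x. \<bar>m\<bar> < \<delta> \<longrightarrow> \<bar>r - 1\<bar> < \<delta> \<longrightarrow> x > K \<longrightarrow>
    \<bar>f ((x - m) / r) / r - f x\<bar> \<le> \<epsilon> * f x"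
proof -
  define Fl where "Fl = (nhds (0::real) \<times>\<^sub>F nhds (1::real)) \<times>\<^sub>F (at_top :: real filter)"
  define T where "T = (\<lambda>x. x powr p * f x)"
  let ?m = "\<lambda>w::(real \<times> real) \<times> real. fst (fst w)" and ?r = "\<lambda>w::(real \<times> real) \<times> real. snd (fst w)"
    and ?x = "\<lambda>w::(real \<times> real) \<times> real. snd w"
  let ?y = "\<lambda>w. (?x w - ?m w) / ?r w"
  have m: "filterlim ?m (nhds 0) Fl" and r: "filterlim ?r (nhds 1) Fl" and x: "filterlim ?x at_top Fl"
    unfolding Fl_def
    by (rule filterlim_compose[OF filterlim_fst filterlim_fst] filterlim_compose[OF filterlim_snd filterlim_fst]
        filterlim_snd)+
  have y: "filterlim ?y at_top Fl"
  proof -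
    have "filterlim (\<lambda>w. - ?m w + ?x w) at_top Fl"
      by (rule filterlim_tendsto_add_at_top[OF tendsto_minus[OF m] x])
    then have "filterlim (\<lambda>w. inverse (?r w) * (- ?m w + ?x w)) at_top Fl"
      by (intro filterlim_tendsto_pos_mult_at_top[OF tendsto_inverse[OF r]]) auto
    then show ?thesis by (simp add: field_simps)
  qed
  have xy: "((\<lambda>w. ?x w / ?y w) \<longlongrightarrow> 1) Fl"
  proof -
    have "((\<lambda>w. ?r w / (1 - ?m w * inverse (?x w))) \<longlongrightarrow> 1 / (1 - 0 * 0)) Fl"
      by (intro tendsto_intros m r tendsto_inverse_0_at_top[OF x]) auto
    moreover have "\<forall>\<^sub>F w in Fl. ?r w / (1 - ?m w * inverse (?x w)) = ?x w / ?y w"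
      using filterlim_at_top_dense[THEN iffD1, OF x, rule_format, of 0]
    proof eventually_elim
      case (elim w)
      then show ?case by (simp add: field_simps)
    qed
    ultimately have "((\<lambda>w. ?x w / ?y w) \<longlongrightarrow> 1 / (1 - 0 * 0)) Fl"
      by (rule Lim_transform_eventually)
    then show ?thesis by simp
  qed
  have ratio: "T y / T x * (x / y) powr p = f y / f x" if "x > 0" "y > 0" "f x > 0" for x y
    using that by (simp add: T_def powr_divide)
  have "((\<lambda>w. T (?y w) / T (?x w) * (?x w / ?y w) powr p / ?r w) \<longlongrightarrow> \<kappa> / \<kappa> * 1 powr p / 1) Fl"
    using \<kappa> unfolding T_def
    by (intro tendsto_intros filterlim_compose[OF tail] x y r xy) auto
  then have "((\<lambda>w. T (?y w) / T (?x w) * (?x w / ?y w) powr p / ?r w) \<longlongrightarrow> 1) Fl"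
    using \<kappa> by simp
  then have "\<forall>\<^sub>F w in Fl. \<bar>T (?y w) / T (?x w) * (?x w / ?y w) powr p / ?r w - 1\<bar> < \<epsilon>"
    using \<epsilon> by (auto simp: tendsto_iff dist_real_def)
  moreover have "\<forall>\<^sub>F w in Fl. ?x w > 0" "\<forall>\<^sub>F w in Fl. ?y w > 0"
    using x y by (auto simp: filterlim_at_top_dense)
  moreover have "\<forall>\<^sub>F w in Fl. T (?x w) > 0"
    using order_tendstoD(1)[OF filterlim_compose[OF tail x] \<kappa>] by (simp add: T_def)
  ultimately have "\<forall>\<^sub>F w in Fl. \<bar>f (?y w) / ?r w - f (?x w)\<bar> \<le> \<epsilon> * f (?x w)"
  proof eventually_elim
    case (elim w)
    have fx: "f (?x w) > 0" using elim by (simp add: T_def zero_less_mult_iff)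
    have "T (?y w) / T (?x w) * (?x w / ?y w) powr p / ?r w = f (?y w) / ?r w / f (?x w)"
      using ratio[of "?x w" "?y w"] elim fx by simp
    then have "\<bar>f (?y w) / ?r w / f (?x w) - 1\<bar> < \<epsilon>" using elim by simp
    then have "\<bar>f (?y w) / ?r w / f (?x w) - 1\<bar> * f (?x w) \<le> \<epsilon> * f (?x w)"
      using fx by (intro mult_right_mono) auto
    moreover have "\<bar>f (?y w) / ?r w / f (?x w) - 1\<bar> * f (?x w) = \<bar>(f (?y w) / ?r w / f (?x w) - 1) * f (?x w)\<bar>"
      using fx by (simp add: abs_mult)
    moreover have "(f (?y w) / ?r w / f (?x w) - 1) * f (?x w) = f (?y w) / ?r w - f (?x w)"
      using fx by (simp add: left_diff_distrib)
    ultimately show ?case by simp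
  qed
  then obtain P1 P2 where P1: "\<forall>\<^sub>F z in nhds (0::real) \<times>\<^sub>F nhds (1::real). P1 z" and P2: "\<forall>\<^sub>F x in at_top. P2 x"
    and P: "\<And>z x. P1 z \<Longrightarrow> P2 x \<Longrightarrow> \<bar>f ((x - fst z) / snd z) / snd z - f x\<bar> \<le> \<epsilon> * f x"
    unfolding Fl_def eventually_prod_filter[of _ "nhds 0 \<times>\<^sub>F nhds 1"] by auto
  obtain Q1 Q2 where Q1: "\<forall>\<^sub>F m in nhds (0::real). Q1 m" and Q2: "\<forall>\<^sub>F r in nhds (1::real). Q2 r"
    and Q: "\<And>m r. Q1 m \<Longrightarrow> Q2 r \<Longrightarrow> P1 (m, r)"
    using P1 unfolding eventually_prod_filter by auto
  obtain d1 where d1: "d1 > 0" "\<And>m. dist m 0 < d1 \<Longrightarrow> Q1 m" using Q1 unfolding eventually_nhds_metric by auto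
  obtain d2 where d2: "d2 > 0" "\<And>r. dist r 1 < d2 \<Longrightarrow> Q2 r" using Q2 unfolding eventually_nhds_metric by auto
  obtain K where K: "\<And>x. x > K \<Longrightarrow> P2 x" using P2 unfolding eventually_at_top_dense by auto
  show ?thesis
  proof (rule exI[of _ "min d1 d2"], intro conjI exI[of _ K] allI impI)
    show "min d1 d2 > 0" using d1 d2 by simp
    fix m r x assume "\<bar>m\<bar> < min d1 d2" "\<bar>r - 1\<bar> < min d1 d2" "K < x"
    then show "\<bar>f ((x - m) / r) / r - f x\<bar> \<le> \<epsilon> * f x"
      using P[OF Q[OF d1(2) d2(2)] K, of m r x] by (auto simp: dist_real_def)
  qed
qed

text \<open>A density with a power tail is positive arbitrarily far to the right.\<close>

lemma cdf_less_1_of_tail_density: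
  assumes "real_distribution \<mu>" and deriv: "\<And>x. (cdf \<mu> has_real_derivative f x) (at x)"
    and tail: "((\<lambda>x. x powr p * f x) \<longlongrightarrow> \<kappa>) at_top" and \<kappa>: "\<kappa> > 0"
  shows "cdf \<mu> K < 1"
proof (rule ccontr)
  interpret real_distribution \<mu> by fact
  assume "\<not> cdf \<mu> K < 1"
  then have one: "cdf \<mu> x = 1" if "x \<ge> K" for x
    using cdf_nondecreasing[OF that] cdf_bounded_prob[of x] by linarith
  have "\<forall>\<^sub>F x in at_top. x powr p * f x > 0" using order_tendstoD(1)[OF tail \<kappa>] .
  then obtain x where x: "x > K" "x powr p * f x > 0"
    using eventually_happens[OF eventually_conj[OF _ eventually_gt_at_top[of K]]] by fastforce
  have "((\<lambda>_. 1::real) has_real_derivative f x) (at x)"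
  proof (rule has_field_derivative_transform_within_open[OF deriv, of "{K<..}"])
    show "\<And>y. y \<in> {K<..} \<Longrightarrow> cdf \<mu> y = 1" using one by simp
  qed (use x in auto)
  then have "f x = 0" using DERIV_unique[OF _ DERIV_const] by blast
  with x show False by simp
qed

lemma cdf_iid_max:
  assumes "prob_space Q" and indep: "prob_space.indep_vars Q (\<lambda>_. borel) Y {1..}"
    and law: "\<And>j. j \<ge> 1 \<Longrightarrow> distr Q borel (Y j) = \<mu>" and n: "n \<ge> (1::nat)"
  shows "(\<lambda>\<omega>. Max ((\<lambda>j. Y j \<omega>) ` {1..n})) \<in> borel_measurable Q"
    and "cdf (distr Q borel (\<lambda>\<omega>. Max ((\<lambda>j. Y j \<omega>) ` {1..n}))) x = cdf \<mu> (x::real) ^ n"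
proof -
  interpret prob_space Q by fact
  have rv [measurable]: "Y j \<in> borel_measurable Q" if "j \<ge> 1" for j
    using indep that by (auto simp: indep_vars_def)
  show meas [measurable]: "(\<lambda>\<omega>. Max ((\<lambda>j. Y j \<omega>) ` {1..n})) \<in> borel_measurable Q"
    by (intro borel_measurable_Max) (auto intro: rv)
  have "cdf (distr Q borel (\<lambda>\<omega>. Max ((\<lambda>j. Y j \<omega>) ` {1..n}))) x = prob ((\<lambda>\<omega>. Max ((\<lambda>j. Y j \<omega>) ` {1..n})) -` {..x} \<inter> space Q)"
    by (simp add: cdf_def measure_distr)
  also have "(\<lambda>\<omega>. Max ((\<lambda>j. Y j \<omega>) ` {1..n})) -` {..x} \<inter> space Q = (\<Inter>j\<in>{1..n}. Y j -` {..x} \<inter> space Q)"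
    using n by (auto simp: Max_le_iff)
  also have "prob \<dots> = (\<Prod>j\<in>{1..n}. prob (Y j -` {..x} \<inter> space Q))"
    using indep n by (intro indep_varsD[of "\<lambda>_. borel" Y "{1..}"]) auto
  also have "\<dots> = (\<Prod>j\<in>{1..n}. cdf \<mu> x)"
  proof (rule prod.cong[OF refl])
    fix j assume "j \<in> {1..n}"
    then have "j \<ge> 1" by simp
    then show "prob (Y j -` {..x} \<inter> space Q) = cdf \<mu> x"
      using law[of j] rv[of j] by (auto simp: cdf_def measure_distr)
  qed
  finally show "cdf (distr Q borel (\<lambda>\<omega>. Max ((\<lambda>j. Y j \<omega>) ` {1..n}))) x = cdf \<mu> x ^ n" by simp
qed

lemma tv_dist_nonneg:
  assumes "prob_space M" "prob_space N"
  shows "0 \<le> tv_dist M U N V"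
proof -
  interpret M: prob_space M by fact
  interpret N: prob_space N by fact
  have "bdd_above ((\<lambda>F. \<bar>\<P>(\<omega> in M. U \<omega> \<in> F) - \<P>(\<omega> in N. V \<omega> \<in> F)\<bar>) ` sets borel)"
  proof (rule bdd_aboveI2)
    fix F
    show "\<bar>\<P>(\<omega> in M. U \<omega> \<in> F) - \<P>(\<omega> in N. V \<omega> \<in> F)\<bar> \<le> 1"
      using M.prob_le_1[of "{\<omega> \<in> space M. U \<omega> \<in> F}"] N.prob_le_1[of "{\<omega> \<in> space N. V \<omega> \<in> F}"]
        measure_nonneg[of M "{\<omega> \<in> space M. U \<omega> \<in> F}"] measure_nonneg[of N "{\<omega> \<in> space N. V \<omega> \<in> F}"]
      by linarith
  qed
  from cSUP_upper[OF _ this, of "{}"] show ?thesis by (simp add: tv_dist_def)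
qed

lemma tv_dist_le:
  assumes [measurable]: "U \<in> borel_measurable M" "V \<in> borel_measurable N"
    and le: "\<And>A. A \<in> sets borel \<Longrightarrow> \<bar>measure (distr M borel U) A - measure (distr N borel V) A\<bar> \<le> b"
  shows "tv_dist M U N V \<le> b"
  unfolding tv_dist_def
proof (rule cSUP_least)
  fix F :: "real set" assume F: "F \<in> sets borel"
  have "measure (distr M borel U) F = \<P>(\<omega> in M. U \<omega> \<in> F)" "measure (distr N borel V) F = \<P>(\<omega> in N. V \<omega> \<in> F)"
    using F by (simp_all add: measure_distr vimage_def Int_def conj_commute)
  with le[OF F] show "\<bar>\<P>(\<omega> in M. U \<omega> \<in> F) - \<P>(\<omega> in N. V \<omega> \<in> F)\<bar> \<le> b" by simp
qed auto

section \<open>The law of the Ornstein-Uhlenbeck process at a fixed time\<close>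

lemma cadlag_locally_bounded:
  assumes f: "cadlag f" and t: "t \<ge> 0"
  obtains d B where "d > 0" "\<And>s. s \<ge> 0 \<Longrightarrow> t - d < s \<Longrightarrow> s < t + d \<Longrightarrow> \<bar>f s\<bar> \<le> B"
proof -
  have ev: "\<forall>\<^sub>F s in F. \<bar>f s\<bar> \<le> \<bar>l\<bar> + 1" if "(f \<longlongrightarrow> l) F" for l :: real and F
  proof -
    have "((\<lambda>s. \<bar>f s\<bar>) \<longlongrightarrow> \<bar>l\<bar>) F" using that by (rule tendsto_rabs)
    then have "\<forall>\<^sub>F s in F. \<bar>f s\<bar> < \<bar>l\<bar> + 1" by (rule order_tendstoD) simp
    then show ?thesis by eventually_elim simp
  qed
  have "(f \<longlongrightarrow> f t) (at_right t)" using f t by (simp add: cadlag_def)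
  from ev[OF this] obtain b where b: "b > t" "\<And>s. t < s \<Longrightarrow> s < b \<Longrightarrow> \<bar>f s\<bar> \<le> \<bar>f t\<bar> + 1"
    unfolding eventually_at_right_field by auto
  obtain a l where a: "a < t" "\<And>s. s \<ge> 0 \<Longrightarrow> a < s \<Longrightarrow> s < t \<Longrightarrow> \<bar>f s\<bar> \<le> \<bar>l\<bar> + 1"
  proof (cases "t > 0")
    case True
    then obtain l where "(f \<longlongrightarrow> l) (at_left t)" using f by (auto simp: cadlag_def)
    from ev[OF this] obtain a where "a < t" "\<And>s. a < s \<Longrightarrow> s < t \<Longrightarrow> \<bar>f s\<bar> \<le> \<bar>l\<bar> + 1"
      unfolding eventually_at_left_field by auto
    then show ?thesis using that by blast
  next
    case False
    then show ?thesis using t that[of "t - 1" 0] by auto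
  qed
  show ?thesis
  proof (rule that[of "min (t - a) (b - t)" "\<bar>l\<bar> + \<bar>f t\<bar> + 1"])
    show "min (t - a) (b - t) > 0" using a b by simp
    fix s assume s: "s \<ge> 0" "t - min (t - a) (b - t) < s" "s < t + min (t - a) (b - t)"
    then have "a < s" "s < b" by auto
    with s show "\<bar>f s\<bar> \<le> \<bar>l\<bar> + \<bar>f t\<bar> + 1"
      using a(2)[of s] b(2)[of s] by (cases s t rule: linorder_cases) auto
  qed
qed

lemma cadlag_bounded:
  assumes f: "cadlag f"
  obtains B where "\<And>s. 0 \<le> s \<Longrightarrow> s \<le> T \<Longrightarrow> \<bar>f s\<bar> \<le> B"
proof -
  have "\<forall>t\<in>{0..T}. \<exists>d B. d > 0 \<and> (\<forall>s\<ge>0. t - d < s \<longrightarrow> s < t + d \<longrightarrow> \<bar>f s\<bar> \<le> B)"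
    using cadlag_locally_bounded[OF f] by (metis atLeastAtMost_iff)
  then obtain d B where d: "\<And>t. t \<in> {0..T} \<Longrightarrow> d t > 0"
    and B: "\<And>t s. t \<in> {0..T} \<Longrightarrow> s \<ge> 0 \<Longrightarrow> t - d t < s \<Longrightarrow> s < t + d t \<Longrightarrow> \<bar>f s\<bar> \<le> B t"
    by metis
  obtain C where C: "C \<subseteq> {0..T}" "finite C" "{0..T} \<subseteq> (\<Union>t\<in>C. {t - d t<..<t + d t})"
  proof (rule compactE_image[of "{0..T}" "{0..T}" "\<lambda>t. {t - d t<..<t + d t}"])
    show "{0..T} \<subseteq> (\<Union>t\<in>{0..T}. {t - d t<..<t + d t})"
      using d by force
  qed auto
  show ?thesis
  proof (rule that[of "\<Sum>t\<in>C. \<bar>B t\<bar>"])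
    fix s assume s: "0 \<le> s" "s \<le> T"
    then obtain t where t: "t \<in> C" "t - d t < s" "s < t + d t" using C(3) by fastforce
    then have "\<bar>f s\<bar> \<le> \<bar>B t\<bar>" using B[of t s] C(1) s by auto
    also have "\<dots> \<le> (\<Sum>t\<in>C. \<bar>B t\<bar>)" using C(2) t(1) by (intro member_le_sum) auto
    finally show "\<bar>f s\<bar> \<le> (\<Sum>t\<in>C. \<bar>B t\<bar>)" .
  qed
qed

text \<open>The equation is solved by testing it against the exponential, on the level of Riemann sums. With
  \<open>w s = exp (- lam * (t - s))\<close>, summation by parts turns the weighted sum of noise increments into the
  boundary terms of \<open>w * x\<close> plus \<open>lam\<close> times the integral of \<open>w (dn s) * x s - w s * x (up s)\<close>, where
  \<open>dn s\<close> and \<open>up s\<close> are the end points of the grid cell of \<open>s\<close>. Taking the weights at left and \<open>x\<close> at right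
  end points lets right continuity of \<open>x\<close> alone send this integrand to \<open>0\<close>.\<close>

lemma OU_discretized_noise:
  fixes x l :: "real \<Rightarrow> real" and lam t :: real
  assumes x: "cadlag x" and lam: "lam > 0" and t: "t > 0"
    and eq: "\<And>u. u \<ge> 0 \<Longrightarrow> x u = x 0 - lam * (LINT s:{0..u}|lborel. x s) + l u"
  shows "(\<lambda>N. \<Sum>k<Suc N. exp (- lam * (t - k * (t / Suc N))) * (l (Suc k * (t / Suc N)) - l (k * (t / Suc N))))
           \<longlonglongrightarrow> x t - exp (- lam * t) * x 0"
proof -
  define w where "w = (\<lambda>s. exp (- lam * (t - s)))"
  define h where "h = (\<lambda>N. t / Suc N)"
  define dn where "dn = (\<lambda>N s. h N * of_int \<lfloor>s / h N\<rfloor>)"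
  define up where "up = (\<lambda>N s. h N * (of_int \<lfloor>s / h N\<rfloor> + 1))"
  have h: "h N > 0" "real (Suc N) * h N = t" for N using t by (auto simp: h_def)
  have h0: "h \<longlonglongrightarrow> 0" unfolding h_def by real_asymp
  have dn: "dn N s \<le> s" "s - h N < dn N s" and up: "s < up N s" "up N s \<le> s + h N" for N s
  proof -
    have "of_int \<lfloor>s / h N\<rfloor> * h N \<le> s" "s < (of_int \<lfloor>s / h N\<rfloor> + 1) * h N"
      unfolding pos_le_divide_eq[OF h(1), symmetric] pos_divide_less_eq[OF h(1), symmetric] by linarith+
    then show "dn N s \<le> s" "s - h N < dn N s" "s < up N s" "up N s \<le> s + h N"
      by (simp_all add: dn_def up_def algebra_simps)
  qed
  have cell: "dn N s = k * h N" "up N s = Suc k * h N" if "s \<in> {k * h N..<Suc k * h N}" for N k s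
  proof -
    have "\<lfloor>s / h N\<rfloor> = int k"
      using that h(1)[of N] by (intro floor_unique) (auto simp: pos_le_divide_eq pos_divide_less_eq add.commute)
    then show "dn N s = k * h N" "up N s = Suc k * h N" by (simp_all add: dn_def up_def algebra_simps)
  qed
  have up_t: "up N s \<le> t" if "0 \<le> s" "s < t" for N s
  proof -
    have "s / h N < real (Suc N)" using that h[of N] by (simp add: pos_divide_less_eq)
    then have "\<lfloor>s / h N\<rfloor> < int (Suc N)" by (simp add: floor_less_iff)
    then have "of_int \<lfloor>s / h N\<rfloor> + 1 \<le> real (Suc N)" by linarith
    then have "h N * (of_int \<lfloor>s / h N\<rfloor> + 1) \<le> h N * real (Suc N)" using h(1)[of N] by (intro mult_left_mono) auto
    then show ?thesis using h(2)[of N] by (simp add: up_def mult.commute)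
  qed
  have dn_lim: "(\<lambda>N. dn N s) \<longlonglongrightarrow> s" for s
  proof (rule real_tendsto_sandwich[where f = "\<lambda>N. s - h N" and h = "\<lambda>_. s"])
    show "(\<lambda>N. s - h N) \<longlonglongrightarrow> s" using tendsto_diff[OF tendsto_const h0] by simp
  qed (auto intro!: always_eventually less_imp_le dn)
  have up_lim: "filterlim (\<lambda>N. up N s) (at_right s) sequentially" for s
    unfolding filterlim_at
  proof
    show "\<forall>\<^sub>F N in sequentially. up N s \<in> {s<..} \<and> up N s \<noteq> s" using up(1)[of s] by (auto simp: less_imp_neq[symmetric] intro!: always_eventually dest: less_imp_neq)
    show "(\<lambda>N. up N s) \<longlonglongrightarrow> s"
    proof (rule real_tendsto_sandwich[where h = "\<lambda>N. s + h N" and f = "\<lambda>_. s"])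
      show "(\<lambda>N. s + h N) \<longlonglongrightarrow> s" using tendsto_add[OF tendsto_const h0] by simp
    qed (auto intro!: always_eventually less_imp_le[OF up(1)] up)
  qed
  have x_up: "(\<lambda>N. x (up N s)) \<longlonglongrightarrow> x s" if "s \<ge> 0" for s
    by (rule filterlim_compose[OF _ up_lim]) (use x that in \<open>simp add: cadlag_def\<close>)
  obtain B where B: "\<And>s. 0 \<le> s \<Longrightarrow> s \<le> t \<Longrightarrow> \<bar>x s\<bar> \<le> B" using cadlag_bounded[OF x] by blast
  have B0: "B \<ge> 0" using B[of 0] t by simp
  have [measurable]: "(\<lambda>s. x (up N s)) \<in> borel_measurable borel" "dn N \<in> borel_measurable borel" for N
  proof -
    have "(\<lambda>i::int. x (h N * (of_int i + 1))) \<in> borel_measurable (count_space UNIV)" by simp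
    then have "(\<lambda>s. (\<lambda>i::int. x (h N * (of_int i + 1))) \<lfloor>s / h N\<rfloor>) \<in> borel_measurable borel"
      by (rule measurable_compose[rotated]) measurable
    then show "(\<lambda>s. x (up N s)) \<in> borel_measurable borel" by (simp add: up_def)
    show "dn N \<in> borel_measurable borel" unfolding dn_def by measurable
  qed
  have w_meas [measurable]: "w \<in> borel_measurable borel" unfolding w_def by measurable
  have w: "0 \<le> w s" "s \<le> t \<Longrightarrow> w s \<le> 1" for s using lam by (auto simp: w_def)
  \<comment> \<open>Right continuity exhibits \<open>x\<close> as a pointwise limit of step functions.\<close>
  have x_meas [measurable]: "(\<lambda>s. indicator {0..<t} s * x s) \<in> borel_measurable borel"
  proof (rule borel_measurable_LIMSEQ_real)
    show "(\<lambda>N. indicator {0..<t} s * x (up N s)) \<longlonglongrightarrow> indicator {0..<t} s * x s" for s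
      using x_up[of s] by (auto simp: indicator_def)
  qed measurable
  have x_int: "set_integrable lborel {a..<b} x" if "0 \<le> a" "b \<le> t" for a b
  proof -
    have "set_integrable lborel {0..<t} x"
      unfolding set_integrable_def
    proof (rule integrableI_bounded_set[where A = "{0..<t}" and B = B])
      show "(\<lambda>s. indicator {0..<t} s *\<^sub>R x s) \<in> borel_measurable lborel" using x_meas by simp
      show "AE s\<in>{0..<t} in lborel. norm (indicator {0..<t} s *\<^sub>R x s) \<le> B" using B by auto
    qed (use t in auto)
    then show ?thesis by (rule set_integrable_subset) (use that in auto)
  qed
  define J where "J = (\<lambda>u. LINT s:{0..<u}|lborel. x s)"
  have J: "(LINT s:{0..u}|lborel. x s) = J u" if "u \<le> t" for u
    unfolding J_def set_lebesgue_integral_def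
  proof (rule integral_cong_AE)
    have "(\<lambda>s. indicator {0..<t} s * x s * indicator {0..<u} s) \<in> borel_measurable lborel" by measurable
    also have "(\<lambda>s. indicator {0..<t} s * x s * indicator {0..<u} s) = (\<lambda>s. indicator {0..<u} s *\<^sub>R x s)"
      using that by (auto simp: indicator_def)
    finally show m: "(\<lambda>s. indicator {0..<u} s *\<^sub>R x s) \<in> borel_measurable lborel" .
    have "(\<lambda>s. indicator {0..<u} s *\<^sub>R x s + (if s = u \<and> 0 \<le> u then x u else 0)) \<in> borel_measurable lborel"
      using m by measurable
    also have "(\<lambda>s. indicator {0..<u} s *\<^sub>R x s + (if s = u \<and> 0 \<le> u then x u else 0)) = (\<lambda>s. indicator {0..u} s *\<^sub>R x s)"
      by (intro ext) (auto simp: indicator_def)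
    finally show "(\<lambda>s. indicator {0..u} s *\<^sub>R x s) \<in> borel_measurable lborel" .
    show "AE s in lborel. indicator {0..u} s *\<^sub>R x s = indicator {0..<u} s *\<^sub>R x s"
      using AE_lborel_singleton[of u] by eventually_elim (auto simp: indicator_def)
  qed
  define D where "D = (\<lambda>N s. w (dn N s) * x s - w s * x (up N s))"
  have D_bound: "\<bar>D N s\<bar> \<le> 2 * B" if "0 \<le> s" "s < t" for N s
  proof -
    have "\<bar>w (dn N s) * x s\<bar> \<le> 1 * B"
      unfolding abs_mult using B[of s] that w(1)[of "dn N s"] w(2)[of "dn N s"] dn(1)[of N s]
      by (intro mult_mono) auto
    moreover have "\<bar>w s * x (up N s)\<bar> \<le> 1 * B"
      unfolding abs_mult using B[of "up N s"] up_t[OF that, of N] that w(1)[of s] w(2)[of s] up(1)[of s N]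
      by (intro mult_mono) auto
    ultimately show ?thesis unfolding D_def by linarith
  qed
  have D_meas [measurable]: "(\<lambda>s. indicator {0..<t} s *\<^sub>R D N s) \<in> borel_measurable borel" for N
  proof -
    have "(\<lambda>s. w (dn N s) * (indicator {0..<t} s * x s) - indicator {0..<t} s * (w s * x (up N s))) \<in> borel_measurable borel"
      by measurable
    then show ?thesis by (simp add: D_def algebra_simps)
  qed
  have D_int: "set_integrable lborel {a..<b} (D N)" if "0 \<le> a" "b \<le> t" for a b N
  proof -
    have "set_integrable lborel {0..<t} (D N)"
      unfolding set_integrable_def
    proof (rule integrableI_bounded_set[where A = "{0..<t}" and B = "2 * B"])
      show "(\<lambda>s. indicator {0..<t} s *\<^sub>R D N s) \<in> borel_measurable lborel" using D_meas by simp
      show "AE s\<in>{0..<t} in lborel. norm (indicator {0..<t} s *\<^sub>R D N s) \<le> 2 * B" using D_bound by auto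
    qed (use t in auto)
    then show ?thesis by (rule set_integrable_subset) (use that in auto)
  qed
  have split: "(LINT s:{0..<b}|lborel. f s) = (LINT s:{0..<a}|lborel. f s) + (LINT s:{a..<b}|lborel. f s)"
    if "0 \<le> a" "a \<le> b" "set_integrable lborel {0..<a} f" "set_integrable lborel {a..<b} f" for a b and f :: "real \<Rightarrow> real"
  proof -
    have "{0..<b} = {0..<a} \<union> {a..<b}" using that by auto
    then show ?thesis using that by (simp add: set_integral_Un)
  qed
  have w_cell: "lam * (LINT s:{a..<b}|lborel. w s) = w b - w a" "set_integrable lborel {a..<b} w" if "a \<le> b" for a b
  proof -
    have w_cont: "continuous_on S w" for S unfolding w_def by (intro continuous_intros)
    have "set_integrable lborel {a..b} w"
      using w_cont by (intro borel_integrable_atLeastAtMost') auto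
    then show "set_integrable lborel {a..<b} w" by (rule set_integrable_subset) auto
    have "(LBINT s. indicator {a..b} s *\<^sub>R (lam * w s)) = w b - w a"
      by (rule integral_FTC_Icc[OF that])
        (auto simp: w_def intro!: derivative_eq_intros continuous_intros simp flip: has_real_derivative_iff_has_vector_derivative)
    moreover have "(LBINT s. indicator {a..b} s *\<^sub>R (lam * w s)) = (LINT s:{a..<b}|lborel. lam * w s)"
      unfolding set_lebesgue_integral_def
    proof (rule integral_cong_AE)
      show "AE s in lborel. indicator {a..b} s *\<^sub>R (lam * w s) = indicator {a..<b} s *\<^sub>R (lam * w s)"
        using AE_lborel_singleton[of b] by eventually_elim (auto simp: indicator_def)
    qed measurable
    ultimately show "lam * (LINT s:{a..<b}|lborel. w s) = w b - w a" by simp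
  qed
  \<comment> \<open>Each grid cell contributes the increment of \<open>w * x\<close> and the integral of \<open>D N\<close> over the cell.\<close>
  have telescope: "(\<Sum>j<k. w (j * h N) * (l (Suc j * h N) - l (j * h N))) =
      w (k * h N) * x (k * h N) - w 0 * x 0 + lam * (LINT s:{0..<k * h N}|lborel. D N s)"
    if "k \<le> Suc N" for k N
    using that
  proof (induction k)
    case 0
    then show ?case by (simp add: set_lebesgue_integral_def)
  next
    case (Suc k)
    let ?a = "k * h N" and ?b = "Suc k * h N"
    have ab: "0 \<le> ?a" "?a \<le> ?b" using h(1)[of N] by (auto simp: mult_right_mono)
    have "?b \<le> real (Suc N) * h N" using Suc.prems h(1)[of N] by (intro mult_right_mono) auto
    then have bt: "?b \<le> t" using h(2)[of N] by simp
    then have at: "?a \<le> t" using ab by linarith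
    have "(LINT s:{?a..<?b}|lborel. D N s) = (LINT s:{?a..<?b}|lborel. w ?a * x s - x ?b * w s)"
      by (rule set_lebesgue_integral_cong) (auto simp: D_def cell simp del: of_nat_Suc)
    also have "\<dots> = w ?a * (LINT s:{?a..<?b}|lborel. x s) - x ?b * (LINT s:{?a..<?b}|lborel. w s)"
      using x_int[OF ab(1) bt] w_cell(2)[OF ab(2)] by (subst set_integral_diff) auto
    also have "(LINT s:{?a..<?b}|lborel. x s) = J ?b - J ?a"
      unfolding J_def using split[OF ab x_int[OF _ at] x_int[OF ab(1) bt]] by simp
    finally have D: "(LINT s:{?a..<?b}|lborel. D N s) = w ?a * (J ?b - J ?a) - x ?b * (LINT s:{?a..<?b}|lborel. w s)" .
    have "lam * (LINT s:{?a..<?b}|lborel. D N s) = lam * w ?a * (J ?b - J ?a) - x ?b * (lam * (LINT s:{?a..<?b}|lborel. w s))"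
      unfolding D by (simp add: right_diff_distrib)
    then have Dcell: "lam * (LINT s:{?a..<?b}|lborel. D N s) = lam * w ?a * (J ?b - J ?a) - x ?b * (w ?b - w ?a)"
      unfolding w_cell(1)[OF ab(2)] .
    have linc: "l ?b - l ?a = x ?b - x ?a + lam * (J ?b - J ?a)"
      using eq[of ?a] eq[of ?b] ab J[OF at] J[OF bt] by (simp add: algebra_simps)
    have inc: "w ?a * (l ?b - l ?a) = w ?a * (x ?b - x ?a) + lam * w ?a * (J ?b - J ?a)"
      unfolding linc by (simp add: algebra_simps)
    have "(LINT s:{0..<?b}|lborel. D N s) = (LINT s:{0..<?a}|lborel. D N s) + (LINT s:{?a..<?b}|lborel. D N s)"
      by (rule split[OF ab D_int[OF _ at] D_int[OF ab(1) bt]]) simp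
    then show ?case
      using Suc.IH Suc.prems Dcell inc by (simp add: algebra_simps del: of_nat_Suc)
  qed
  have "(\<lambda>N. LINT s:{0..<t}|lborel. D N s) \<longlonglongrightarrow> (LINT s|(lborel :: real measure). 0)"
    unfolding set_lebesgue_integral_def
  proof (rule integral_dominated_convergence[where f = "\<lambda>_. 0::real" and w = "\<lambda>s. indicator {0..<t} s *\<^sub>R (2 * B)"])
    show "integrable lborel (\<lambda>s. indicator {0..<t} s *\<^sub>R (2 * B))"
      using t by (intro integrable_scaleR_left integrable_real_indicator) auto
    show "(\<lambda>s. indicator {0..<t} s *\<^sub>R D N s) \<in> borel_measurable lborel" for N using D_meas by simp
    show "AE s in lborel. norm (indicator {0..<t} s *\<^sub>R D N s) \<le> indicator {0..<t} s *\<^sub>R (2 * B)" for N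
      using D_bound by (auto simp: indicator_def)
    show "AE s in lborel. (\<lambda>N. indicator {0..<t} s *\<^sub>R D N s) \<longlonglongrightarrow> 0"
    proof (rule AE_I2)
      fix s :: real
      have "(\<lambda>N. D N s) \<longlonglongrightarrow> w s * x s - w s * x s" if "s \<ge> 0"
        unfolding D_def w_def by (intro tendsto_intros dn_lim x_up that)
      then show "(\<lambda>N. indicator {0..<t} s *\<^sub>R D N s) \<longlonglongrightarrow> 0" by (auto simp: indicator_def)
    qed
  qed auto
  then have "(\<lambda>N. w t * x t - w 0 * x 0 + lam * (LINT s:{0..<t}|lborel. D N s)) \<longlonglongrightarrow> w t * x t - w 0 * x 0 + lam * 0"
    by (intro tendsto_intros) simp
  moreover have "w t * x t - w 0 * x 0 + lam * (LINT s:{0..<t}|lborel. D N s) =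
      (\<Sum>k<Suc N. exp (- lam * (t - k * (t / Suc N))) * (l (Suc k * (t / Suc N)) - l (k * (t / Suc N))))" for N
    using telescope[of "Suc N" N] h(2)[of N] by (simp add: w_def h_def)
  ultimately show ?thesis by (simp add: w_def)
qed

lemma char_scale:
  assumes [measurable]: "Y \<in> borel_measurable M"
  shows "char (distr M borel (\<lambda>\<omega>. a * Y \<omega>)) z = char (distr M borel Y) (a * z)"
  unfolding char_def by (simp add: integral_distr mult_ac)

lemma char_affine:
  assumes [measurable]: "Y \<in> borel_measurable M"
  shows "char (distr M borel (\<lambda>\<omega>. m + a * Y \<omega>)) z = iexp (m * z) * char (distr M borel Y) (a * z)"
  unfolding char_def by (simp add: integral_distr ring_distribs exp_add mult_ac)

lemma char_limit:
  assumes "prob_space M" and [measurable]: "\<And>n. Y n \<in> borel_measurable M" "Y' \<in> borel_measurable M"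
    and lim: "AE \<omega> in M. (\<lambda>n::nat. Y n \<omega>) \<longlonglongrightarrow> Y' \<omega>"
  shows "(\<lambda>n. char (distr M borel (Y n)) z) \<longlonglongrightarrow> char (distr M borel Y') z"
proof -
  interpret prob_space M by fact
  have "(\<lambda>n. CLINT \<omega>|M. iexp (z * Y n \<omega>)) \<longlonglongrightarrow> (CLINT \<omega>|M. iexp (z * Y' \<omega>))"
  proof (rule integral_dominated_convergence[where w = "\<lambda>_. 1"])
    show "AE \<omega> in M. (\<lambda>n. iexp (z * Y n \<omega>)) \<longlonglongrightarrow> iexp (z * Y' \<omega>)"
      using lim by eventually_elim (intro tendsto_intros)
  qed auto
  then show ?thesis unfolding char_def by (simp add: integral_distr)
qed

locale stable_levy = prob_space M for M :: "'a measure" +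
  fixes L :: "real \<Rightarrow> 'a \<Rightarrow> real" and c \<alpha> :: real
  assumes levy: "levy_process M L" and c: "c > 0" and \<alpha>: "\<alpha> > 0"
    and char_L1: "\<And>z. char (distr M borel (L 1)) z = complex_of_real (exp (- c * \<bar>z\<bar> powr \<alpha>))"
begin

lemma L_meas [measurable]: "t \<ge> 0 \<Longrightarrow> L t \<in> borel_measurable M"
  and L_0: "AE \<omega> in M. L 0 \<omega> = 0"
  and L_stationary: "s \<ge> 0 \<Longrightarrow> h \<ge> 0 \<Longrightarrow> distr M borel (\<lambda>\<omega>. L (s + h) \<omega> - L s \<omega>) = distr M borel (L h)"
  and L_cadlag: "AE \<omega> in M. cadlag (\<lambda>t. L t \<omega>)"
  using levy by (simp_all add: levy_process_def)

lemma char_weighted_increments: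
  assumes h: "h \<ge> 0"
  shows "char (distr M borel (\<lambda>\<omega>. \<Sum>k<N. w k * (L (real (Suc k) * h) \<omega> - L (real k * h) \<omega>))) z =
    (\<Prod>k<N. char (distr M borel (L h)) (w k * z))"
proof -
  have "indep_vars (\<lambda>_. borel) (\<lambda>k \<omega>. L (real (Suc k) * h) \<omega> - L (real k * h) \<omega>) {..<N}"
    using levy h unfolding levy_process_def
    by (elim conjE) (drule spec[of _ N], drule spec[of _ "\<lambda>k. real k * h"], simp add: mult_right_mono)
  then have "indep_vars (\<lambda>_. borel) (\<lambda>k \<omega>. w k * (L (real (Suc k) * h) \<omega> - L (real k * h) \<omega>)) {..<N}"
    by (rule indep_vars_compose2) simp
  then have "char (distr M borel (\<lambda>\<omega>. \<Sum>k<N. w k * (L (real (Suc k) * h) \<omega> - L (real k * h) \<omega>))) z =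
    (\<Prod>k<N. char (distr M borel (\<lambda>\<omega>. w k * (L (real (Suc k) * h) \<omega> - L (real k * h) \<omega>))) z)"
    by (rule char_distr_sum)
  also have "\<dots> = (\<Prod>k<N. char (distr M borel (L h)) (w k * z))"
  proof (rule prod.cong[OF refl])
    fix k
    have "distr M borel (\<lambda>\<omega>. L (real (Suc k) * h) \<omega> - L (real k * h) \<omega>) = distr M borel (L h)"
      using L_stationary[of "real k * h" h] h by (simp add: algebra_simps)
    moreover have "(\<lambda>\<omega>. L (real (Suc k) * h) \<omega> - L (real k * h) \<omega>) \<in> borel_measurable M"
      using h by (intro borel_measurable_diff L_meas) auto
    ultimately show "char (distr M borel (\<lambda>\<omega>. w k * (L (real (Suc k) * h) \<omega> - L (real k * h) \<omega>))) z
       = char (distr M borel (L h)) (w k * z)"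
      by (simp add: char_scale del: of_nat_Suc)
  qed
  finally show ?thesis .
qed

lemma char_L_multiple:
  assumes h: "h \<ge> 0"
  shows "char (distr M borel (L (real N * h))) z = char (distr M borel (L h)) z ^ N"
proof -
  have "distr M borel (L (real N * h)) = distr M borel (\<lambda>\<omega>. \<Sum>k<N. 1 * (L (real (Suc k) * h) \<omega> - L (real k * h) \<omega>))"
  proof (rule distr_cong_AE)
    show "AE \<omega> in M. L (real N * h) \<omega> = (\<Sum>k<N. 1 * (L (real (Suc k) * h) \<omega> - L (real k * h) \<omega>))"
      using L_0
    proof eventually_elim
      case (elim \<omega>)
      then show ?case using sum_lessThan_telescope[of "\<lambda>k. L (real k * h) \<omega>" N] by simp
    qed
    show "L (real N * h) \<in> borel_measurable M" using h by simp
    show "(\<lambda>\<omega>. \<Sum>k<N. 1 * (L (real (Suc k) * h) \<omega> - L (real k * h) \<omega>)) \<in> borel_measurable M"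
      using h by (intro borel_measurable_sum borel_measurable_times borel_measurable_diff L_meas) auto
  qed auto
  then show ?thesis
    using char_weighted_increments[OF h, of "\<lambda>_. 1" N z] by simp
qed

text \<open>The \<open>N\<close>-th power of the characteristic function of \<open>L (1 / N)\<close> is known. The root is determined because
  the quotient \<open>\<psi>\<close> of the two candidate functions is a continuous function of \<open>z\<close> with values in the finite
  set of \<open>N\<close>-th roots of unity, hence constant.\<close>

lemma char_L_inverse_nat:
  assumes N: "N > 0"
  shows "char (distr M borel (L (1 / real N))) z = complex_of_real (exp (- c * (1 / N) * \<bar>z\<bar> powr \<alpha>))"
proof -
  interpret D: real_distribution "distr M borel (L (1 / real N))"
    by (rule real_distribution_distr) simp
  define \<psi> where "\<psi> = (\<lambda>z. char (distr M borel (L (1 / real N))) z * complex_of_real (exp (c * (1 / N) * \<bar>z\<bar> powr \<alpha>)))"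
  have root: "\<psi> z ^ N = 1" for z
  proof -
    have "char (distr M borel (L (1 / real N))) z ^ N = complex_of_real (exp (- c * \<bar>z\<bar> powr \<alpha>))"
      using char_L_multiple[of "1 / real N" N z] N char_L1[of z] by simp
    moreover have "complex_of_real (exp (c * (1 / N) * \<bar>z\<bar> powr \<alpha>)) ^ N = complex_of_real (exp (c * \<bar>z\<bar> powr \<alpha>))"
      using N by (simp flip: of_real_power exp_of_nat_mult)
    ultimately show ?thesis by (simp add: \<psi>_def power_mult_distrib flip: of_real_mult exp_add)
  qed
  have "continuous_on UNIV \<psi>"
    unfolding \<psi>_def using \<alpha>
    by (intro continuous_intros continuous_on_powr' continuous_at_imp_continuous_on ballI D.isCont_char) auto
  moreover have "finite (range \<psi>)"
    by (rule finite_subset[of _ "{w. w ^ N = 1}"]) (use root N in \<open>auto intro!: finite_roots_unity\<close>)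
  ultimately have "\<psi> constant_on UNIV"
    by (intro continuous_finite_range_constant) auto
  then have "\<psi> z = \<psi> 0" by (auto simp: constant_on_def)
  also have "\<psi> 0 = 1" using D.char_zero by (simp add: \<psi>_def)
  finally show ?thesis
    by (simp add: \<psi>_def exp_minus field_simps)
qed

text \<open>Rational times follow from the previous two lemmas; a real time is the limit from the right of
  rational ones, and the paths are right continuous.\<close>

lemma char_L:
  assumes h: "h \<ge> 0"
  shows "char (distr M borel (L h)) z = complex_of_real (exp (- c * h * \<bar>z\<bar> powr \<alpha>))"
proof -
  define q where "q = (\<lambda>n. real (nat \<lfloor>h * Suc n\<rfloor> + 1) * (1 / Suc n))"
  have q: "h < q n" "q n \<le> h + 1 / Suc n" for n
  proof -
    have fl: "real (nat \<lfloor>h * Suc n\<rfloor>) = of_int \<lfloor>h * Suc n\<rfloor>" using h by simp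
    have "h * Suc n < of_int \<lfloor>h * Suc n\<rfloor> + 1" "of_int \<lfloor>h * Suc n\<rfloor> \<le> h * Suc n" by linarith+
    then show "h < q n" "q n \<le> h + 1 / Suc n"
      unfolding q_def of_nat_add of_nat_1 fl by (simp_all add: pos_less_divide_eq pos_divide_le_eq ring_distribs del: of_nat_Suc)
  qed
  have q_lim: "q \<longlonglongrightarrow> h"
  proof (rule real_tendsto_sandwich)
    show "\<forall>\<^sub>F n in sequentially. h \<le> q n" "\<forall>\<^sub>F n in sequentially. q n \<le> h + 1 / Suc n"
      by (rule always_eventually, rule allI, rule q less_imp_le[OF q(1)])+
    show "(\<lambda>n. h + 1 / Suc n) \<longlonglongrightarrow> h" by real_asymp
  qed simp
  then have q_right: "filterlim q (at_right h) sequentially"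
    unfolding filterlim_at using q(1) by (auto intro!: always_eventually dest: less_imp_neq simp: less_imp_neq[symmetric])
  have char_q: "char (distr M borel (L (q n))) z = complex_of_real (exp (- c * q n * \<bar>z\<bar> powr \<alpha>))" for n
  proof -
    have "char (distr M borel (L (q n))) z = complex_of_real (exp (- c * (1 / Suc n) * \<bar>z\<bar> powr \<alpha>)) ^ (nat \<lfloor>h * Suc n\<rfloor> + 1)"
      unfolding q_def by (subst char_L_multiple) (simp_all only: char_L_inverse_nat zero_less_Suc, simp)
    also have "\<dots> = complex_of_real (exp (real (nat \<lfloor>h * Suc n\<rfloor> + 1) * (- c * (1 / Suc n) * \<bar>z\<bar> powr \<alpha>)))"
      by (simp only: of_real_power[symmetric] exp_of_nat_mult)
    also have "real (nat \<lfloor>h * Suc n\<rfloor> + 1) * (- c * (1 / Suc n) * \<bar>z\<bar> powr \<alpha>) = - c * q n * \<bar>z\<bar> powr \<alpha>"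
      unfolding q_def by (simp only: mult_ac)
    finally show ?thesis .
  qed
  have "(\<lambda>n. char (distr M borel (L (q n))) z) \<longlonglongrightarrow> char (distr M borel (L h)) z"
  proof (rule char_limit)
    show "AE \<omega> in M. (\<lambda>n. L (q n) \<omega>) \<longlonglongrightarrow> L h \<omega>"
      using L_cadlag
    proof eventually_elim
      case (elim \<omega>)
      then have "((\<lambda>t. L t \<omega>) \<longlongrightarrow> L h \<omega>) (at_right h)" using h by (simp add: cadlag_def)
      then show ?case using q_right by (rule filterlim_compose)
    qed
    show "L (q n) \<in> borel_measurable M" for n using q(1)[of n] h by simp
  qed (use h in \<open>auto intro: prob_space_axioms\<close>)
  moreover have "(\<lambda>n. char (distr M borel (L (q n))) z) \<longlonglongrightarrow> complex_of_real (exp (- c * h * \<bar>z\<bar> powr \<alpha>))"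
    unfolding char_q by (intro tendsto_intros q_lim)
  ultimately show ?thesis by (rule LIMSEQ_unique)
qed

text \<open>The Riemann sums \<open>S N\<close> are linear combinations of independent increments. Their characteristic exponents
  form a geometric sum, which converges to the integral of \<open>exp (- lam * \<alpha> * (t - s))\<close> over \<open>[0, t]\<close>.\<close>

lemma OU_char:
  assumes lam: "lam > 0" and t: "t > 0" and X: "OU_strong_solution M lam x0 L X"
  shows "char (distr M borel (X t)) z = iexp (exp (- lam * t) * x0 * z) *
    complex_of_real (exp (- (c / (lam * \<alpha>)) * (1 - exp (- lam * \<alpha> * t)) * \<bar>z\<bar> powr \<alpha>))"
proof -
  define a where "a = lam * \<alpha>"
  have a: "a > 0" using lam \<alpha> by (simp add: a_def)
  define S where "S = (\<lambda>N \<omega>. \<Sum>k<Suc N. exp (- lam * (t - k * (t / Suc N))) *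
      (L (Suc k * (t / Suc N)) \<omega> - L (k * (t / Suc N)) \<omega>))"
  have X_meas [measurable]: "X t \<in> borel_measurable M" using X t by (simp add: OU_strong_solution_def)
  have char_S: "char (distr M borel (S N)) z =
      complex_of_real (exp (- c * ((t / Suc N) / (exp (a * (t / Suc N)) - 1) * (1 - exp (- a * t))) * \<bar>z\<bar> powr \<alpha>))" for N
  proof -
    define h where "h = t / Suc N"
    have h: "h > 0" "real (Suc N) * h = t" using t by (simp_all add: h_def)
    have "char (distr M borel (S N)) z = (\<Prod>k<Suc N. char (distr M borel (L h)) (exp (- lam * (t - k * h)) * z))"
      unfolding S_def h_def by (rule char_weighted_increments) (use t in auto)
    also have "\<dots> = (\<Prod>k<Suc N. complex_of_real (exp (- c * h * \<bar>z\<bar> powr \<alpha> * exp (- a * t) * exp (a * h) ^ k)))"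
    proof (rule prod.cong[OF refl])
      fix k :: nat
      have "\<bar>exp (- lam * (t - k * h)) * z\<bar> powr \<alpha> = exp (- lam * (t - k * h)) powr \<alpha> * \<bar>z\<bar> powr \<alpha>"
        by (simp add: abs_mult powr_mult)
      also have "exp (- lam * (t - k * h)) powr \<alpha> = exp (- a * t) * exp (a * h) ^ k"
        by (simp add: powr_def a_def algebra_simps flip: exp_add exp_of_nat_mult)
      finally show "char (distr M borel (L h)) (exp (- lam * (t - k * h)) * z) =
          complex_of_real (exp (- c * h * \<bar>z\<bar> powr \<alpha> * exp (- a * t) * exp (a * h) ^ k))"
        using h by (simp add: char_L mult_ac)
    qed
    also have "\<dots> = complex_of_real (exp (\<Sum>k<Suc N. - c * h * \<bar>z\<bar> powr \<alpha> * exp (- a * t) * exp (a * h) ^ k))"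
      by (simp only: exp_sum[OF finite_lessThan] of_real_prod)
    also have "(\<Sum>k<Suc N. - c * h * \<bar>z\<bar> powr \<alpha> * exp (- a * t) * exp (a * h) ^ k) =
        - c * h * \<bar>z\<bar> powr \<alpha> * exp (- a * t) * (\<Sum>k<Suc N. exp (a * h) ^ k)"
      by (rule sum_distrib_left[symmetric])
    also have "(\<Sum>k<Suc N. exp (a * h) ^ k) = (exp (a * h) ^ Suc N - 1) / (exp (a * h) - 1)"
      by (rule geometric_sum) (use a h in auto)
    also have "exp (a * h) ^ Suc N = exp (a * t)"
      using h by (simp only: exp_of_nat_mult[symmetric]) (simp add: mult_ac)
    also have "- c * h * \<bar>z\<bar> powr \<alpha> * exp (- a * t) * ((exp (a * t) - 1) / (exp (a * h) - 1)) =
        - c * (h / (exp (a * h) - 1) * (exp (- a * t) * (exp (a * t) - 1))) * \<bar>z\<bar> powr \<alpha>"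
      by (simp add: mult_ac)
    also have "exp (- a * t) * (exp (a * t) - 1) = 1 - exp (- a * t)"
      by (simp add: right_diff_distrib flip: exp_add)
    finally show ?thesis by (simp only: h_def)
  qed
  have "(\<lambda>N. char (distr M borel (S N)) z) \<longlonglongrightarrow> char (distr M borel (\<lambda>\<omega>. X t \<omega> - exp (- lam * t) * x0)) z"
  proof (rule char_limit)
    show "AE \<omega> in M. (\<lambda>N. S N \<omega>) \<longlonglongrightarrow> X t \<omega> - exp (- lam * t) * x0"
    proof -
      have "AE \<omega> in M. cadlag (\<lambda>t. X t \<omega>)" "AE \<omega> in M. X 0 \<omega> = x0"
        "AE \<omega> in M. \<forall>t\<ge>0. X t \<omega> = X 0 \<omega> - lam * (LINT s:{0..t}|lborel. X s \<omega>) + L t \<omega>"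
        using X by (simp_all add: OU_strong_solution_def)
      then show ?thesis
      proof eventually_elim
        case (elim \<omega>)
        have "(\<lambda>N. S N \<omega>) \<longlonglongrightarrow> X t \<omega> - exp (- lam * t) * X 0 \<omega>"
          unfolding S_def by (rule OU_discretized_noise[OF elim(1) lam t elim(3)[rule_format]])
        then show ?case by (simp only: elim(2))
      qed
    qed
    show "S N \<in> borel_measurable M" for N
      unfolding S_def using t
      by (intro borel_measurable_sum borel_measurable_times borel_measurable_diff L_meas) auto
  qed (auto intro: prob_space_axioms)
  moreover have "(\<lambda>N. char (distr M borel (S N)) z) \<longlonglongrightarrow>
     complex_of_real (exp (- c * (1 / a * (1 - exp (- a * t))) * \<bar>z\<bar> powr \<alpha>))"
  proof -
    have "(\<lambda>N. (t / Suc N) / (exp (a * (t / Suc N)) - 1)) \<longlonglongrightarrow> 1 / a"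
    proof -
      have "((\<lambda>y. y / (exp (a * y) - 1)) \<longlongrightarrow> 1 / a) (at_right 0)"
        using a by real_asymp (simp add: inverse_eq_divide)
      moreover have "filterlim (\<lambda>N. t / real (Suc N)) (at_right 0) sequentially"
        using t by real_asymp
      ultimately show ?thesis by (rule filterlim_compose)
    qed
    note lim = this
    show ?thesis unfolding char_S
      by (rule lim tendsto_of_real tendsto_exp tendsto_mult tendsto_const)+
  qed
  ultimately have "char (distr M borel (\<lambda>\<omega>. X t \<omega> - exp (- lam * t) * x0)) z =
      complex_of_real (exp (- c * (1 / a * (1 - exp (- a * t))) * \<bar>z\<bar> powr \<alpha>))"
    by (rule LIMSEQ_unique)
  moreover have "char (distr M borel (X t)) z = iexp (exp (- lam * t) * x0 * z) *
     char (distr M borel (\<lambda>\<omega>. X t \<omega> - exp (- lam * t) * x0)) z"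
    using char_affine[of "\<lambda>\<omega>. X t \<omega> - exp (- lam * t) * x0" M "exp (- lam * t) * x0" 1 z] by simp
  ultimately show ?thesis by (simp add: a_def)
qed

end

text \<open>At each time the process is distributed like an affine image of its stationary law.\<close>

lemma OU_law:
  fixes lam c \<alpha> x0 t :: real
  assumes lam: "lam > 0" and c: "c > 0" and \<alpha>: "\<alpha> > 0" and levy: "levy_process M L"
    and char_L1: "\<And>z. char (distr M borel (L 1)) z = complex_of_real (exp (- c * \<bar>z\<bar> powr \<alpha>))"
    and X: "OU_strong_solution M lam x0 L X" and t: "t > 0"
  defines "\<mu> \<equiv> distr M borel (\<lambda>\<omega>. (1 / (lam * \<alpha>)) powr (1 / \<alpha>) * L 1 \<omega>)"
  shows "char \<mu> z = complex_of_real (exp (- (c / (lam * \<alpha>)) * \<bar>z\<bar> powr \<alpha>))"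
    and "distr M borel (X t) =
      distr \<mu> borel (\<lambda>y. exp (- lam * t) * x0 + (1 - exp (- lam * \<alpha> * t)) powr (1 / \<alpha>) * y)"
proof -
  interpret prob_space M using levy by (simp add: levy_process_def)
  interpret stable_levy M L c \<alpha> by standard (use assms in auto)
  have X_meas [measurable]: "X t \<in> borel_measurable M" using X t by (simp add: OU_strong_solution_def)
  have sc: "\<bar>s powr (1 / \<alpha>) * z\<bar> powr \<alpha> = s * \<bar>z\<bar> powr \<alpha>" if "s \<ge> 0" for s z
    using that \<alpha> by (simp add: abs_mult powr_mult powr_powr)
  have char_\<mu>: "char \<mu> z = complex_of_real (exp (- (c / (lam * \<alpha>)) * \<bar>z\<bar> powr \<alpha>))" for z
    unfolding \<mu>_def using lam \<alpha> by (simp add: char_scale char_L1 sc)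
  then show "char \<mu> z = complex_of_real (exp (- (c / (lam * \<alpha>)) * \<bar>z\<bar> powr \<alpha>))" .
  have [simp]: "sets \<mu> = sets borel" "space \<mu> = UNIV" by (simp_all add: \<mu>_def)
  interpret \<mu>: real_distribution \<mu> unfolding \<mu>_def by (rule real_distribution_distr) simp
  let ?r = "(1 - exp (- lam * \<alpha> * t)) powr (1 / \<alpha>)" and ?m = "exp (- lam * t) * x0"
  show "distr M borel (X t) = distr \<mu> borel (\<lambda>y. ?m + ?r * y)"
  proof (rule Levy_uniqueness)
    show "char (distr M borel (X t)) = char (distr \<mu> borel (\<lambda>y. ?m + ?r * y))"
    proof
      fix z
      have "exp (- lam * \<alpha> * t) \<le> 1" using lam \<alpha> t by simp
      moreover have "distr \<mu> borel (\<lambda>y. y) = \<mu>" by (rule distr_id2) simp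
      ultimately show "char (distr M borel (X t)) z = char (distr \<mu> borel (\<lambda>y. ?m + ?r * y)) z"
        unfolding OU_char[OF lam t X] by (subst char_affine) (simp_all add: char_\<mu> sc)
    qed
  qed auto
qed

section \<open>Absence of cut-off\<close>

lemma iid_process_copies_marginal:
  assumes iid: "iid_process_copies N Xs M X" and t: "t \<ge> 0"
    and X: "\<And>t. t \<ge> 0 \<Longrightarrow> X t \<in> borel_measurable M"
  shows "prob_space.indep_vars N (\<lambda>_. borel) (\<lambda>j. Xs j t) {1..}"
    and "j \<ge> 1 \<Longrightarrow> distr N borel (Xs j t) = distr M borel (X t)"
proof -
  interpret prob_space N using iid by (simp add: iid_process_copies_def)
  have indep: "indep_vars (\<lambda>_. path_space) (\<lambda>j. path (Xs j)) {1..}"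
    using iid by (simp add: iid_process_copies_def)
  have comp [measurable]: "(\<lambda>p. p t) \<in> measurable path_space borel"
    using t by (intro measurable_component_singleton) auto
  have "indep_vars (\<lambda>_. borel) (\<lambda>j \<omega>. path (Xs j) \<omega> t) {1..}"
    by (rule indep_vars_compose2[OF indep]) (rule comp)
  then show "indep_vars (\<lambda>_. borel) (\<lambda>j. Xs j t) {1..}" using t by (simp add: path_def)
  assume j: "j \<ge> 1"
  have m1: "path (Xs j) \<in> measurable N path_space" using indep j by (auto simp: indep_vars_def)
  have m2: "path X \<in> measurable M path_space"
    unfolding path_def[abs_def] by (intro measurable_restrict X) auto
  have "distr (distr N path_space (path (Xs j))) borel (\<lambda>p. p t) = distr (distr M path_space (path X)) borel (\<lambda>p. p t)"
    using iid j by (simp add: iid_process_copies_def)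
  then show "distr N borel (Xs j t) = distr M borel (X t)"
    using t by (simp add: distr_distr[OF comp m1] distr_distr[OF comp m2] o_def path_def)
qed

lemma cdf_affine:
  assumes "sets \<mu> = sets borel" "r > 0"
  shows "cdf (distr \<mu> borel (\<lambda>y::real. m + r * y)) x = cdf \<mu> ((x - m) / r)"
proof -
  have [measurable_cong]: "sets \<mu> = sets borel" by fact
  have "(\<lambda>y. m + r * y) -` {..x} \<inter> space \<mu> = {..(x - m) / r}"
    using assms sets_eq_imp_space_eq[OF assms(1)] by (auto simp: field_simps)
  then show ?thesis by (simp add: cdf_def measure_distr)
qed

theorem theorem1p3:
  fixes lam c \<alpha> x0 :: real
    and M :: "'a measure" and L X :: "real \<Rightarrow> 'a \<Rightarrow> real"
    and N :: "'b measure" and Xs :: "nat \<Rightarrow> real \<Rightarrow> 'b \<Rightarrow> real"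
    and P :: "'c measure" and Xinfs :: "nat \<Rightarrow> 'c \<Rightarrow> real"
  assumes "lam > 0" and "c > 0" and "0 < \<alpha>" and "\<alpha> < 2"
    and "levy_process M L"
    and "\<And>z. char (distr M borel (L 1)) z = complex_of_real (exp (- c * \<bar>z\<bar> powr \<alpha>))"
    and "OU_strong_solution M lam x0 L X"
    and "iid_process_copies N Xs M X"
    and "iid_copies P Xinfs M (\<lambda>\<omega>. (1 / (lam * \<alpha>)) powr (1 / \<alpha>) * L 1 \<omega>)"
  shows "(\<forall>t :: nat \<Rightarrow> real. filterlim t at_top sequentially \<longrightarrow>
            (\<lambda>n. tv_dist N (max_process Xs n (t n)) P (max_variable Xinfs n)) \<longlonglongrightarrow> 0) \<and>
         \<not> (\<exists>tc. has_cutoff N (max_process Xs) P (max_variable Xinfs) tc)"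
proof -
  interpret M: prob_space M using assms(5) by (simp add: levy_process_def)
  interpret N: prob_space N using assms(8) by (simp add: iid_process_copies_def)
  interpret P: prob_space P using assms(9) by (simp add: iid_copies_def)
  define \<mu> where "\<mu> = distr M borel (\<lambda>\<omega>. (1 / (lam * \<alpha>)) powr (1 / \<alpha>) * L 1 \<omega>)"
  have "L 1 \<in> borel_measurable M" using assms(5) by (simp add: levy_process_def)
  then have \<mu>: "real_distribution \<mu>" unfolding \<mu>_def by (intro M.real_distribution_distr) auto
  interpret \<mu>: real_distribution \<mu> by fact
  note OU = OU_law[OF assms(1,2,3,5,6,7), folded \<mu>_def]
  obtain f \<kappa> where f: "\<And>x. (cdf \<mu> has_real_derivative f x) (at x)" "f \<in> borel_measurable borel" "\<And>x. 0 \<le> f x"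
    and \<kappa>: "\<kappa> > 0" "((\<lambda>x. x powr (1 + \<alpha>) * f x) \<longlongrightarrow> \<kappa>) at_top"
    using stable_density[OF \<mu>, of "c / (lam * \<alpha>)" \<alpha>] OU(1)[of 1] assms(1-4) by auto
  have X_meas: "\<And>t. t \<ge> 0 \<Longrightarrow> X t \<in> borel_measurable M" using assms(7) by (simp add: OU_strong_solution_def)
  have exp_0: "((\<lambda>s::real. exp (- a * s)) \<longlongrightarrow> 0) at_top" if "a > 0" for a
    using that by real_asymp
  have main: "(\<lambda>n. tv_dist N (max_process Xs n (t n)) P (max_variable Xinfs n)) \<longlonglongrightarrow> 0"
    if t: "filterlim t at_top sequentially" for t :: "nat \<Rightarrow> real"
  proof -
    define m r where "m = (\<lambda>n. exp (- lam * t n) * x0)" and "r = (\<lambda>n. (1 - exp (- lam * \<alpha> * t n)) powr (1 / \<alpha>))"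
    have m0: "m \<longlonglongrightarrow> 0"
    proof -
      from tendsto_mult_left_zero[OF filterlim_compose[OF exp_0[OF \<open>lam > 0\<close>] t]] show ?thesis by (simp only: m_def)
    qed
    have r1: "r \<longlonglongrightarrow> 1"
    proof -
      have "lam * \<alpha> > 0" using \<open>lam > 0\<close> \<open>0 < \<alpha>\<close> by simp
      from filterlim_compose[OF exp_0[OF this] t] have "(\<lambda>n. exp (- lam * \<alpha> * t n)) \<longlonglongrightarrow> 0" by simp
      then have "r \<longlonglongrightarrow> (1 - 0) powr (1 / \<alpha>)" unfolding r_def by (intro tendsto_intros) auto
      then show ?thesis by simp
    qed
    \<comment> \<open>Both error terms of \<open>max_law_close\<close> are made small: first \<open>\<epsilon>\<close> fixes the threshold \<open>K\<close>, then \<open>n\<close> grows.\<close>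
    have bound: "\<forall>\<^sub>F n in sequentially. tv_dist N (max_process Xs n (t n)) P (max_variable Xinfs n) < 4 * \<epsilon>"
      if \<epsilon>: "0 < \<epsilon>" "\<epsilon> \<le> 1" for \<epsilon>
    proof -
      obtain K \<delta> where \<delta>: "\<delta> > 0" and close: "\<forall>m r x. \<bar>m\<bar> < \<delta> \<longrightarrow> \<bar>r - 1\<bar> < \<delta> \<longrightarrow> x > K \<longrightarrow>
          \<bar>f ((x - m) / r) / r - f x\<bar> \<le> \<epsilon> * f x"
        using tail_density_affine_stable[OF \<kappa>(2,1) \<epsilon>(1)] by (elim exE conjE)
      have "cdf \<mu> K < 1" using cdf_less_1_of_tail_density[OF \<mu> f(1) \<kappa>(2,1)] .
      then have "(\<lambda>n. cdf \<mu> K ^ n) \<longlonglongrightarrow> 0" using \<mu>.cdf_nonneg[of K] by (intro LIMSEQ_realpow_zero) auto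
      then have "\<forall>\<^sub>F n in sequentially. cdf \<mu> K ^ n < \<epsilon>" by (rule order_tendstoD) (rule \<epsilon>)
      moreover have "\<forall>\<^sub>F n in sequentially. \<bar>m n\<bar> < \<delta>" "\<forall>\<^sub>F n in sequentially. \<bar>r n - 1\<bar> < \<delta>"
        using tendstoD[OF m0 \<delta>] tendstoD[OF r1 \<delta>] by (simp_all add: dist_real_def)
      moreover have "\<forall>\<^sub>F n in sequentially. r n > 0" using r1 by (rule order_tendstoD) simp
      moreover have "\<forall>\<^sub>F n in sequentially. t n > 0" using t by (simp add: filterlim_at_top_dense)
      ultimately show ?thesis
        using eventually_ge_at_top[of 1]
      proof eventually_elim
        case (elim n)
        define \<nu> where "\<nu> = distr M borel (X (t n))"
        define g where "g = (\<lambda>x. f ((x - m n) / r n) / r n)"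
        have [measurable]: "f \<in> borel_measurable borel" by (rule f)
        have cdf_\<nu>: "cdf \<nu> = (\<lambda>x. cdf \<mu> ((x - m n) / r n))"
          using OU(2)[OF elim(5)] cdf_affine[of \<mu> "r n" "m n"] elim(4)
          by (auto simp: \<nu>_def m_def r_def)
        have g: "(cdf \<nu> has_real_derivative g x) (at x)" for x
        proof -
          have "((\<lambda>x. (x - m n) / r n) has_real_derivative 1 / r n) (at x)"
            using elim(4) by (auto intro!: derivative_eq_intros)
          from DERIV_chain2[OF f(1) this] show ?thesis by (simp add: cdf_\<nu> g_def)
        qed
        note indep_X = iid_process_copies_marginal[OF assms(8) less_imp_le[OF elim(5)] X_meas]
        have indep_Xinf: "P.indep_vars (\<lambda>_. borel) Xinfs {1..}" "\<And>j. j \<ge> 1 \<Longrightarrow> distr P borel (Xinfs j) = \<mu>"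
          using assms(9) by (simp_all add: iid_copies_def \<mu>_def)
        note maxX = cdf_iid_max[OF N.prob_space_axioms indep_X(1) indep_X(2) elim(6), folded \<nu>_def]
        note maxXinf = cdf_iid_max[OF P.prob_space_axioms indep_Xinf elim(6)]
        have [measurable]: "max_process Xs n (t n) \<in> borel_measurable N" "max_variable Xinfs n \<in> borel_measurable P"
          using maxX(1) maxXinf(1) by (simp_all add: max_process_def[abs_def] max_variable_def[abs_def])
        have "tv_dist N (max_process Xs n (t n)) P (max_variable Xinfs n) \<le> cdf \<mu> K ^ n + 2 * \<epsilon>"
        proof (rule tv_dist_le)
          fix A :: "real set" assume A: "A \<in> sets borel"
          have "\<bar>measure (distr P borel (max_variable Xinfs n)) A - measure (distr N borel (max_process Xs n (t n))) A\<bar>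
              \<le> cdf \<mu> K ^ n + 2 * \<epsilon>"
          proof (rule max_law_close[of \<mu> \<nu> _ _ n f g])
            show "real_distribution \<nu>" unfolding \<nu>_def using X_meas elim(5) by (intro M.real_distribution_distr) auto
            show "cdf (distr P borel (max_variable Xinfs n)) x = cdf \<mu> x ^ n" for x
              using maxXinf(2) by (simp add: max_variable_def[abs_def])
            show "cdf (distr N borel (max_process Xs n (t n))) x = cdf \<nu> x ^ n" for x
              using maxX(2) by (simp add: max_process_def[abs_def])
            show "g \<in> borel_measurable borel" unfolding g_def by measurable
            show "0 \<le> g x" for x using f(3) elim(4) by (simp add: g_def)
            show "\<bar>g x - f x\<bar> \<le> \<epsilon> * f x" if "x > K" for x
              using close[rule_format, OF elim(2,3) that] by (simp add: g_def)
          qed (use \<mu> f g \<epsilon> A elim(6) in \<open>auto intro: N.real_distribution_distr P.real_distribution_distr\<close>)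
          then show "\<bar>measure (distr N borel (max_process Xs n (t n))) A - measure (distr P borel (max_variable Xinfs n)) A\<bar>
              \<le> cdf \<mu> K ^ n + 2 * \<epsilon>" by (simp add: abs_minus_commute)
        qed auto
        with elim(1) \<epsilon> show ?case by linarith
      qed
    qed
    show ?thesis
    proof (rule LIMSEQ_I, goal_cases)
      case (1 e)
      have "\<forall>\<^sub>F n in sequentially. tv_dist N (max_process Xs n (t n)) P (max_variable Xinfs n) < 4 * min 1 (e / 4)"
        using 1 by (intro bound) auto
      then obtain n0 where "\<And>n. n \<ge> n0 \<Longrightarrow> tv_dist N (max_process Xs n (t n)) P (max_variable Xinfs n) < 4 * min 1 (e / 4)"
        unfolding eventually_sequentially by blast
      then have "norm (tv_dist N (max_process Xs n (t n)) P (max_variable Xinfs n) - 0) < e" if "n \<ge> n0" for n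
        using that tv_dist_nonneg[OF N.prob_space_axioms P.prob_space_axioms, of "max_process Xs n (t n)" "max_variable Xinfs n"]
        by (fastforce simp: min_def split: if_splits)
      then show ?case by blast
    qed
  qed
  moreover have "\<not> has_cutoff N (max_process Xs) P (max_variable Xinfs) tc" for tc
  proof
    assume cutoff: "has_cutoff N (max_process Xs) P (max_variable Xinfs) tc"
    then have "filterlim tc at_top sequentially" by (simp add: has_cutoff_def)
    then have "filterlim (\<lambda>n. 1 / 2 * tc n) at_top sequentially"
      by (intro filterlim_tendsto_pos_mult_at_top[OF tendsto_const]) auto
    from main[OF this] have "(\<lambda>n. tv_dist N (max_process Xs n (1 / 2 * tc n)) P (max_variable Xinfs n)) \<longlonglongrightarrow> 0" .
    moreover have "(\<lambda>n. tv_dist N (max_process Xs n (1 / 2 * tc n)) P (max_variable Xinfs n)) \<longlonglongrightarrow> 1"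
      using cutoff unfolding has_cutoff_def by (elim conjE allE[of _ "1 / 2"]) auto
    ultimately show False using LIMSEQ_unique by fastforce
  qed
  ultimately show ?thesis by blast
qed

end
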